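(* Let $p>2$, $\beta=1/(p-1)$, $R,T>0$, and let $u\in C^{2,1}(Q_{R,T})$ be a classical solution of $u_t-\Delta u=|\nabla u|^p$ in $Q_{R,T}:=B_R\times(0,T)$. (i) For each $a\in[0,1)$ there exists $C=C(n,p,a)>0$ (independent of $u,R,T$) such that $$a|\nabla u|^p-u_t\le C\big(R^{-\beta-1}+R^{1-\beta}t^{-1}\big)\quad\text{in } B_{R/2}\times(0,T).$$ (ii) There exists $C=C(n,p)>0$ such that for all $0<t<s<T$ and all $x,y\in B_{R/2}$, $$u(x,t)\le u(y,s)+C\Big(\frac{|y-x|^p}{s-t}\Big)^{\beta}+C\big(R^{-\beta-1}+R^{1-\beta}t^{-1}\big)(s-t).$$
   Context: $B_R:=\{x\in\mathbb{R}^n: |x|<R\}$. *)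

theory Defs
  imports "HOL-Analysis.Analysis"
begin

definition Qcyl :: "real \<Rightarrow> real \<Rightarrow> ('a::euclidean_space \<times> real) set" where
  "Qcyl R T = ball 0 R \<times> {0<..<T}"

text \<open>Classical C^{2,1} solution of u_t - \<Delta>u = |\<nabla>u|^p in Q_{R,T}.
  gu x t is the spatial gradient, Hu x t the spatial Hessian (as a linear map, the derivative
  of the gradient), ut x t the time derivative. Since Q is open these are uniquely determined
  by u. Regularity: u, gu, Hu (all entries), ut are jointly continuous on Q.\<close>
definition classical_sol ::
  "real \<Rightarrow> real \<Rightarrow> real \<Rightarrow> ('a::euclidean_space \<Rightarrow> real \<Rightarrow> real) \<Rightarrow> ('a \<Rightarrow> real \<Rightarrow> 'a)
     \<Rightarrow> ('a \<Rightarrow> real \<Rightarrow> 'a \<Rightarrow> 'a) \<Rightarrow> ('a \<Rightarrow> real \<Rightarrow> real) \<Rightarrow> bool" where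
  "classical_sol p R T u gu Hu ut \<longleftrightarrow>
     (\<forall>x t. (x, t) \<in> Qcyl R T \<longrightarrow>
        ((\<lambda>y. u y t) has_derivative (\<lambda>h. gu x t \<bullet> h)) (at x) \<and>
        ((\<lambda>y. gu y t) has_derivative Hu x t) (at x) \<and>
        ((\<lambda>s. u x s) has_real_derivative ut x t) (at t) \<and>
        ut x t - (\<Sum>i\<in>Basis. Hu x t i \<bullet> i) = norm (gu x t) powr p) \<and>
     continuous_on (Qcyl R T) (\<lambda>(x, t). u x t) \<and>
     continuous_on (Qcyl R T) (\<lambda>(x, t). gu x t) \<and>
     (\<forall>i\<in>Basis. continuous_on (Qcyl R T) (\<lambda>(x, t). Hu x t i)) \<and>
     continuous_on (Qcyl R T) (\<lambda>(x, t). ut x t)"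

end

(* After rescaling to R = 1 one applies Bernstein's method to
     w = a (1 + |grad u|^2)^(p/2) - u_t.
   By convexity of |q|^p, the linearised operator d/dt - Laplace - p |grad u|^(p-2) grad u . grad
   sends -u_t to a nonpositive quantity and w to at most -c (1 + |grad u|^2)^(p/2-1) |D^2 u|^2.
   Where w is large, -Laplace u = |grad u|^p - u_t is at least w/2 + (1-a)/2 |grad u|^p, so the
   Hessian term has the strength of w^2 and a barrier A (d^(-2) + 1/(t - t1)) with
   d = 9/16 - |x|^2 cannot be touched from below by w. Since grad u and u_t are only once
   (or not at all) differentiable, they are replaced by difference quotients of u.
   Part (ii) integrates (i) with a = 1/2 along the segment from (x,t) to (y,s) and absorbs the
   transport term by Young's inequality. *)
theory Submission
  imports Defs "HOL-Real_Asymp.Real_Asymp"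
begin

text \<open>The constant must not depend on the solution, but the speed at which difference
  quotients approach derivatives does. The order of choices resolves this: \<open>Ca\<close> and
  \<open>B\<close> are fixed from n, p, a alone, with room to spare; only then come the gradient
  bound \<open>M\<close>, the error \<open>eps\<close> and the step \<open>h\<close>, and every
  error has to fit into a fixed gap. The quotients behave differently under the linearised operator.
  The time quotient leaves minus a convexity remainder, which has the right sign for every
  \<open>h\<close>. The space quotients leave remainders multiplied by factors of unknown sign, so
  these must be shown to vanish with \<open>h\<close>. The summand 1 in 1 + |grad u|^2 keeps the
  coefficient of the Hessian term away from zero where grad u vanishes, and it swallows the error
  between |grad u|^2 and its quotients. The power d^(-2) matches the Hessian term: with A = B^2 the
  squared barrier carries B^4 d^(-4), against B^2 d^(-4) from the Laplacian and B^3 d^(-4) from the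
  drift, up to powers of the gradient. The value 9/16 = (3/4)^2 puts the blow-up strictly between
  the radii 1/2 and 1.\<close>

section \<open>Convexity of the p-th power of the norm\<close>

lemma Young_powr:
  fixes p r s :: real
  assumes "p > 1" "r \<ge> 0" "s \<ge> 0"
  shows "p * r powr (p - 1) * s \<le> (p - 1) * r powr p + s powr p"
proof -
  have "s * r powr (p - 1) \<le> s powr p / p + (r powr (p - 1)) powr (p / (p - 1)) / (p / (p - 1))"
    using assms by (intro Youngs_inequality) (auto simp: field_simps)
  moreover have "(r powr (p - 1)) powr (p / (p - 1)) = r powr p"
    using assms by (simp add: powr_powr)
  ultimately have "s * r powr (p - 1) \<le> s powr p / p + r powr p * (p - 1) / p" by simp
  from mult_left_mono[OF this, of p] show ?thesis
    using assms by (simp add: distrib_left mult_ac)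
qed

text \<open>Cauchy-Schwarz reduces the tangent plane inequality to the scalar one for r^p, which is
  Young's inequality. Nothing is differentiated, so q = 0 causes no trouble.\<close>

lemma norm_powr_convex:
  fixes q q' :: "'a::real_inner"
  assumes "p > 2"
  shows "norm q powr p + (p * norm q powr (p - 2)) * (q \<bullet> (q' - q)) \<le> norm q' powr p"
proof -
  have sq: "norm q powr (p - 2) * (norm q * norm q) = norm q powr p"
    by (cases "norm q = 0") (use assms in \<open>auto simp: powr_diff power2_eq_square\<close>)
  have one: "norm q powr (p - 2) * norm q = norm q powr (p - 1)"
    by (cases "norm q = 0") (use assms in \<open>auto simp: powr_diff power2_eq_square\<close>)
  have "norm q powr (p - 2) * (q \<bullet> q') \<le> norm q powr (p - 2) * (norm q * norm q')"
    by (intro mult_left_mono norm_cauchy_schwarz) auto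
  also have "\<dots> = norm q powr (p - 1) * norm q'"
    by (simp add: one[symmetric])
  finally have "p * (norm q powr (p - 2) * (q \<bullet> q')) \<le> p * (norm q powr (p - 1) * norm q')"
    using assms by (intro mult_left_mono) auto
  also have "\<dots> \<le> (p - 1) * norm q powr p + norm q' powr p"
    using Young_powr[of p "norm q" "norm q'"] assms by (simp add: mult.assoc)
  finally have "p * (norm q powr (p - 2) * (q \<bullet> q')) \<le> (p - 1) * norm q powr p + norm q' powr p" .
  moreover have "norm q powr (p - 2) * (q \<bullet> q) = norm q powr p"
    by (simp add: sq[symmetric] dot_square_norm power2_eq_square mult_ac)
  ultimately show ?thesis by (simp add: inner_diff_right algebra_simps)
qed

section \<open>First and second order conditions at a maximum\<close>

text \<open>A positive \<open>f''\<close> would make \<open>f'\<close> positive just to the right of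
  0, and \<open>f\<close> would climb above its maximum there.\<close>

lemma DERIV_interior_max_second:
  fixes f f' :: "real \<Rightarrow> real"
  assumes e: "e > 0" and f': "\<And>s. \<bar>s\<bar> < e \<Longrightarrow> (f has_real_derivative f' s) (at s)"
    and f'': "(f' has_real_derivative f'') (at 0)" and max: "\<And>s. \<bar>s\<bar> < e \<Longrightarrow> f s \<le> f 0"
  shows "f' 0 = 0" "f'' \<le> 0"
proof -
  show z: "f' 0 = 0"
    by (rule DERIV_local_max[OF f'[of 0] e]) (use e max in auto)
  show "f'' \<le> 0"
  proof (rule ccontr)
    assume "\<not> f'' \<le> 0"
    with DERIV_pos_inc_right[OF f''] z obtain d where d: "d > 0" "\<And>s. 0 < s \<Longrightarrow> s < d \<Longrightarrow> 0 < f' s"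
      by auto
    define s where "s = min d e / 2"
    have s: "0 < s" "s < d" "s < e" using d e by (auto simp: s_def)
    have "f 0 < f s"
      by (rule DERIV_pos_imp_increasing_open[OF s(1)])
        (use d s f' in \<open>force intro!: continuous_at_imp_continuous_on DERIV_isCont\<close>)+
    with max[of s] s show False by auto
  qed
qed

text \<open>Only earlier times are compared, because the maximum over a space-time region may lie on
  its final time slice.\<close>

lemma DERIV_left_max:
  fixes f :: "real \<Rightarrow> real"
  assumes e: "e > 0" and f': "(f has_real_derivative f') (at t)"
    and max: "\<And>s. t - e < s \<Longrightarrow> s \<le> t \<Longrightarrow> f s \<le> f t"
  shows "f' \<ge> 0"
proof (rule ccontr)
  assume "\<not> f' \<ge> 0"
  with DERIV_neg_dec_left[OF f'] obtain d where d: "d > 0" "\<And>s. 0 < s \<Longrightarrow> s < d \<Longrightarrow> f t < f (t - s)"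
    by auto
  define s where "s = min d e / 2"
  have "0 < s" "s < d" "s < e" using d e by (auto simp: s_def)
  with max[of "t - s"] d(2)[of s] show False by auto
qed

lemma DERIV_energy:
  fixes c :: "'i \<Rightarrow> real \<Rightarrow> real"
  assumes "\<And>i. i \<in> I \<Longrightarrow> (c i has_real_derivative c1 i) (at s)"
  shows "((\<lambda>s. (1 + (\<Sum>i\<in>I. (c i s)\<^sup>2)) powr r) has_real_derivative
    2 * r * (1 + (\<Sum>i\<in>I. (c i s)\<^sup>2)) powr (r - 1) * (\<Sum>i\<in>I. c i s * c1 i)) (at s)"
proof -
  have pos: "0 < 1 + (\<Sum>i\<in>I. (c i s)\<^sup>2)" by (intro add_pos_nonneg sum_nonneg) auto
  have "((\<lambda>s. 1 + (\<Sum>i\<in>I. (c i s)\<^sup>2)) has_real_derivative 2 * (\<Sum>i\<in>I. c i s * c1 i)) (at s)"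
    by (auto intro!: derivative_eq_intros assms simp: sum_distrib_left mult_ac)
  from DERIV_fun_powr[OF this pos, of r] show ?thesis by (simp add: mult_ac)
qed

text \<open>The functions \<open>c i\<close> stand for the space quotients of u, \<open>D\<close>
  for the negative time quotient and \<open>\<psi>\<close> for the barrier. Keeping them abstract
  separates the calculus from the equation.\<close>

lemma energy_max_time:
  fixes c :: "'i \<Rightarrow> real \<Rightarrow> real"
  assumes "e > 0" and "\<And>i. i \<in> I \<Longrightarrow> (c i has_real_derivative c1 i) (at t)"
    and "(D has_real_derivative D1) (at t)" "(\<psi> has_real_derivative \<psi>1) (at t)"
    and "\<And>s. t - e < s \<Longrightarrow> s \<le> t \<Longrightarrow>
      a * (1 + (\<Sum>i\<in>I. (c i s)\<^sup>2)) powr (p/2) + D s - \<psi> s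
        \<le> a * (1 + (\<Sum>i\<in>I. (c i t)\<^sup>2)) powr (p/2) + D t - \<psi> t"
  shows "\<psi>1 \<le> a * (p * (1 + (\<Sum>i\<in>I. (c i t)\<^sup>2)) powr (p/2 - 1)) * (\<Sum>i\<in>I. c i t * c1 i) + D1"
proof -
  have "0 \<le> a * (p * (1 + (\<Sum>i\<in>I. (c i t)\<^sup>2)) powr (p/2 - 1)) * (\<Sum>i\<in>I. c i t * c1 i) + D1 - \<psi>1"
  proof (rule DERIV_left_max[where t = t and f = "\<lambda>s. a * (1 + (\<Sum>i\<in>I. (c i s)\<^sup>2)) powr (p/2) + D s - \<psi> s",
        OF assms(1) _ assms(5)])
    show "((\<lambda>s. a * (1 + (\<Sum>i\<in>I. (c i s)\<^sup>2)) powr (p/2) + D s - \<psi> s) has_real_derivative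
       a * (p * (1 + (\<Sum>i\<in>I. (c i t)\<^sup>2)) powr (p/2 - 1)) * (\<Sum>i\<in>I. c i t * c1 i) + D1 - \<psi>1) (at t)"
      using DERIV_cmult[OF DERIV_energy[where r = "p/2", OF assms(2)], where c = a] assms(3,4)
      by (auto intro!: DERIV_add DERIV_diff simp: mult.assoc)
  qed
  then show ?thesis by simp
qed

text \<open>Differentiating the energy twice along a line gives the squares of \<open>c1 i\<close>,
  the future Hessian term, a term with \<open>c2 i\<close>, which the equation will replace, and a
  term with the square of the first derivative. The last one is nonnegative and is dropped.\<close>

lemma energy_max_space:
  fixes c c1 :: "'i \<Rightarrow> real \<Rightarrow> real"
  assumes e: "e > 0" and a: "a \<ge> 0" and p: "p \<ge> 2"
    and c: "\<And>i s. i \<in> I \<Longrightarrow> \<bar>s\<bar> < e \<Longrightarrow> (c i has_real_derivative c1 i s) (at s)"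
    and c1: "\<And>i. i \<in> I \<Longrightarrow> (c1 i has_real_derivative c2 i) (at 0)"
    and D: "\<And>s. \<bar>s\<bar> < e \<Longrightarrow> (D has_real_derivative D1 s) (at s)"
    and D1: "(D1 has_real_derivative D2) (at 0)"
    and \<psi>: "\<And>s. \<bar>s\<bar> < e \<Longrightarrow> (\<psi> has_real_derivative \<psi>1 s) (at s)"
    and \<psi>1: "(\<psi>1 has_real_derivative \<psi>2) (at 0)"
    and max: "\<And>s. \<bar>s\<bar> < e \<Longrightarrow>
      a * (1 + (\<Sum>i\<in>I. (c i s)\<^sup>2)) powr (p/2) + D s - \<psi> s
        \<le> a * (1 + (\<Sum>i\<in>I. (c i 0)\<^sup>2)) powr (p/2) + D 0 - \<psi> 0"
  shows "a * (p * (1 + (\<Sum>i\<in>I. (c i 0)\<^sup>2)) powr (p/2 - 1)) * (\<Sum>i\<in>I. c i 0 * c1 i 0) + D1 0 = \<psi>1 0"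
    and "a * (p * (1 + (\<Sum>i\<in>I. (c i 0)\<^sup>2)) powr (p/2 - 1)) * (\<Sum>i\<in>I. (c1 i 0)\<^sup>2 + c i 0 * c2 i) + D2 \<le> \<psi>2"
proof -
  define m where "m s = 1 + (\<Sum>i\<in>I. (c i s)\<^sup>2)" for s
  define S where "S s = (\<Sum>i\<in>I. c i s * c1 i s)" for s
  define f' where "f' s = a * (p * m s powr (p/2 - 1)) * S s + D1 s - \<psi>1 s" for s
  define f'' where "f'' = a * (p * ((p - 2) * m 0 powr (p/2 - 2) * S 0) * S 0
      + p * m 0 powr (p/2 - 1) * (\<Sum>i\<in>I. (c1 i 0)\<^sup>2 + c i 0 * c2 i)) + D2 - \<psi>2"
  have d1: "((\<lambda>s. a * m s powr (p/2) + D s - \<psi> s) has_real_derivative f' s) (at s)" if "\<bar>s\<bar> < e" for s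
    using DERIV_cmult[OF DERIV_energy[where r = "p/2", OF c[OF _ that]], where c = a] D[OF that] \<psi>[OF that]
    by (auto intro!: DERIV_add DERIV_diff simp: mult.assoc f'_def m_def S_def)
  have dS: "(S has_real_derivative (\<Sum>i\<in>I. (c1 i 0)\<^sup>2 + c i 0 * c2 i)) (at 0)"
    unfolding S_def using e
    by (auto intro!: derivative_eq_intros c c1 sum.cong simp: power2_eq_square mult_ac)
  have "((\<lambda>s. m s powr (p/2 - 1)) has_real_derivative (p - 2) * m 0 powr (p/2 - 2) * S 0) (at 0)"
    using DERIV_energy[where r = "p/2 - 1" and s = 0 and I = I, OF c] e unfolding m_def S_def
    by (auto simp: algebra_simps)
  from DERIV_diff[OF DERIV_add[OF DERIV_cmult[OF DERIV_mult[OF DERIV_cmult[OF this] dS], where c = a] D1] \<psi>1, of p]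
  have d2: "(f' has_real_derivative f'') (at 0)"
    by (rule DERIV_cong_ev[THEN iffD1, rotated -1]) (auto simp: f'_def f''_def algebra_simps)
  note M = DERIV_interior_max_second[OF e d1 d2 max[folded m_def]]
  from M(1) show "a * (p * (1 + (\<Sum>i\<in>I. (c i 0)\<^sup>2)) powr (p/2 - 1)) * (\<Sum>i\<in>I. c i 0 * c1 i 0) + D1 0 = \<psi>1 0"
    by (simp add: f'_def m_def S_def)
  \<comment> \<open>This is the contribution of differentiating the power
    \<open>m s powr (p/2 - 1)\<close> itself; it has a sign because p is at least 2.\<close>
  have "0 \<le> a * (p * ((p - 2) * m 0 powr (p/2 - 2) * S 0) * S 0)"
  proof -
    have "a * (p * ((p - 2) * m 0 powr (p/2 - 2) * S 0) * S 0) = a * p * (p - 2) * m 0 powr (p/2 - 2) * (S 0)\<^sup>2"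
      by (simp add: power2_eq_square mult_ac)
    also have "\<dots> \<ge> 0" using a p by auto
    finally show ?thesis .
  qed
  with M(2) show "a * (p * (1 + (\<Sum>i\<in>I. (c i 0)\<^sup>2)) powr (p/2 - 1)) * (\<Sum>i\<in>I. (c1 i 0)\<^sup>2 + c i 0 * c2 i) + D2 \<le> \<psi>2"
    by (simp add: f''_def m_def algebra_simps)
qed

section \<open>The gradient of |q|^p and uniform difference quotients\<close>

text \<open>The gradient of |q|^p, which is also the drift vector of the linearised
  equation.\<close>

definition norm_powr_grad :: "real \<Rightarrow> 'a::real_inner \<Rightarrow> 'a"
  where "norm_powr_grad p q = (p * norm q powr (p - 2)) *\<^sub>R q"

lemma norm_norm_powr_grad:
  assumes "p > 2"
  shows "norm (norm_powr_grad p q) = p * norm q powr (p - 1)"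
  by (cases "norm q = 0") (use assms in \<open>auto simp: norm_powr_grad_def powr_diff power2_eq_square\<close>)

lemma continuous_on_norm_powr_grad:
  assumes "p > 2"
  shows "continuous_on S (norm_powr_grad p)"
  unfolding norm_powr_grad_def using assms
  by (intro continuous_intros continuous_on_powr') auto

text \<open>The lower bound is convexity at \<open>q\<close>, the upper bound convexity at \<open>q'\<close>.\<close>
lemma norm_powr_remainder:
  fixes q q' :: "'a::real_inner"
  assumes "p > 2"
  shows "0 \<le> norm q' powr p - norm q powr p - norm_powr_grad p q \<bullet> (q' - q)"
    and "norm q' powr p - norm q powr p - norm_powr_grad p q \<bullet> (q' - q)
      \<le> norm (norm_powr_grad p q' - norm_powr_grad p q) * norm (q' - q)"
proof -
  have *: "norm x powr p + norm_powr_grad p x \<bullet> (y - x) \<le> norm y powr p" for x y :: 'a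
    using norm_powr_convex[OF assms, of x y] by (simp add: norm_powr_grad_def mult.assoc)
  show "0 \<le> norm q' powr p - norm q powr p - norm_powr_grad p q \<bullet> (q' - q)"
    using *[of q q'] by simp
  have "(norm_powr_grad p q' - norm_powr_grad p q) \<bullet> (q' - q)
      \<le> norm (norm_powr_grad p q' - norm_powr_grad p q) * norm (q' - q)"
    by (rule norm_cauchy_schwarz)
  with *[of q' q] show "norm q' powr p - norm q powr p - norm_powr_grad p q \<bullet> (q' - q)
      \<le> norm (norm_powr_grad p q' - norm_powr_grad p q) * norm (q' - q)"
    by (simp add: inner_diff_left inner_diff_right)
qed

text \<open>The mean value inequality compares the quotient with the derivative at nearby points of
  the segment, and uniform continuity of the derivative on the compact \<open>K\<close> makes this
  independent of \<open>z\<close>. With a direction \<open>v\<close> in the product space it serves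
  space shifts and time shifts alike.\<close>

lemma difference_quotient_uniform:
  fixes f :: "'b::real_normed_vector \<Rightarrow> 'c::real_normed_vector"
  assumes K: "compact K" and \<phi>: "continuous_on K \<phi>" and h1: "h1 > 0" and eps: "eps > 0"
    and seg: "\<And>z s. z \<in> Z \<Longrightarrow> 0 \<le> s \<Longrightarrow> s \<le> h1 \<Longrightarrow> z + s *\<^sub>R v \<in> K"
    and der: "\<And>z s. z \<in> Z \<Longrightarrow> 0 \<le> s \<Longrightarrow> s \<le> h1 \<Longrightarrow>
      ((\<lambda>r. f (z + r *\<^sub>R v)) has_vector_derivative \<phi> (z + s *\<^sub>R v)) (at s)"
  shows "eventually (\<lambda>h. \<forall>z\<in>Z. norm ((f (z + h *\<^sub>R v) - f z) /\<^sub>R h - \<phi> z) \<le> eps) (at_right 0)"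
proof -
  have "uniformly_continuous_on K \<phi>" using K \<phi> by (rule compact_uniformly_continuous[rotated])
  then obtain d where d: "d > 0" "\<And>x y. x \<in> K \<Longrightarrow> y \<in> K \<Longrightarrow> dist x y < d \<Longrightarrow> dist (\<phi> x) (\<phi> y) < eps"
    unfolding uniformly_continuous_on_def using eps by metis
  \<comment> \<open>The summand 1 keeps the quotient meaningful for v = 0 and makes the displacement
    strictly smaller than \<open>d\<close>.\<close>
  define h0 where "h0 = min h1 (d / (norm v + 1))"
  have pos: "norm v + 1 > 0" using norm_ge_zero[of v] by linarith
  have h0: "h0 > 0" using h1 d(1) pos by (simp add: h0_def)
  show ?thesis
    unfolding eventually_at_right_field
  proof (intro exI[of _ h0] conjI allI impI ballI h0)
    fix h z assume h: "0 < h" "h < h0" and z: "z \<in> Z"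
    have "norm ((\<lambda>r. f (z + r *\<^sub>R v)) h - (\<lambda>r. f (z + r *\<^sub>R v)) 0 - (h - 0) *\<^sub>R \<phi> (z + 0 *\<^sub>R v)) \<le> norm (h - 0) * eps"
    proof (rule vector_differentiable_bound_linearization[where S = "{0..h}"])
      fix s assume s: "s \<in> {0..h}"
      then show "((\<lambda>r. f (z + r *\<^sub>R v)) has_vector_derivative \<phi> (z + s *\<^sub>R v)) (at s within {0..h})"
        using der[OF z, of s] h by (auto simp: h0_def intro: has_vector_derivative_at_within)
      have "s * norm v \<le> h * (norm v + 1)" using s h by (intro mult_mono) auto
      also have "\<dots> < d" using h pos by (auto simp: h0_def field_simps)
      finally have "dist (z + s *\<^sub>R v) (z + 0 *\<^sub>R v) < d" using s by (simp add: dist_norm)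
      moreover have "z + s *\<^sub>R v \<in> K" "z + 0 *\<^sub>R v \<in> K" using s h h1 by (auto simp: h0_def intro!: seg[OF z] seg[OF z, of 0, simplified])
      ultimately show "norm (\<phi> (z + s *\<^sub>R v) - \<phi> (z + 0 *\<^sub>R v)) \<le> eps"
        using d(2) by (fastforce simp: dist_norm)
    qed (use h in \<open>auto simp: closed_segment_eq_real_ivl\<close>)
    then have "norm (f (z + h *\<^sub>R v) - f z - h *\<^sub>R \<phi> z) \<le> h * eps" using h by simp
    moreover have "f (z + h *\<^sub>R v) - f z - h *\<^sub>R \<phi> z = h *\<^sub>R ((f (z + h *\<^sub>R v) - f z) /\<^sub>R h - \<phi> z)"
      using h by (simp add: algebra_simps)
    ultimately have "h * norm ((f (z + h *\<^sub>R v) - f z) /\<^sub>R h - \<phi> z) \<le> h * eps"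
      using h by simp
    then show "norm ((f (z + h *\<^sub>R v) - f z) /\<^sub>R h - \<phi> z) \<le> eps" using h by simp
  qed
qed

section \<open>Algebra of the barrier\<close>

text \<open>The choice \<open>A = B\<^sup>2\<close> makes the cross term harmless:
  \<open>r / d\<^sup>3 \<le> B / d\<^sup>4 + r\<^sup>4 / B\<^sup>3\<close>.\<close>
lemma cross_term_bound:
  fixes r z B :: real
  assumes "r \<ge> 0" "z \<ge> 0" "B > 0"
  shows "B\<^sup>2 * (r * z^3) \<le> B^3 * z^4 + r^4 / B"
proof (cases "r \<le> B * z")
  case True
  then have "B\<^sup>2 * (r * z^3) \<le> B\<^sup>2 * (B * z * z^3)" using assms by (intro mult_left_mono mult_right_mono) auto
  also have "\<dots> = B^3 * z^4" by (simp add: eval_nat_numeral)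
  also have "\<dots> \<le> B^3 * z^4 + r^4 / B" using assms by simp
  finally show ?thesis .
next
  case False
  then have "B * z \<le> r" by simp
  then have "(B * z)^3 * r \<le> r^3 * r" using assms by (intro mult_right_mono power_mono) auto
  then have "B * (B\<^sup>2 * (r * z^3)) \<le> r^4" by (simp add: eval_nat_numeral mult_ac)
  then have "B\<^sup>2 * (r * z^3) \<le> r^4 / B" using assms by (simp add: field_simps)
  moreover have "0 \<le> B^3 * z^4" using assms by simp
  ultimately show ?thesis by linarith
qed

text \<open>Here \<open>z = 1/d\<close> and \<open>w = 1/\<tau>\<close> are the singular factors of the barrier \<open>B\<^sup>2(z\<^sup>2 + w)\<close>,
  and \<open>m\<close> stands for \<open>(1 + r\<^sup>2) powr (p/2 - 1)\<close>.\<close>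
lemma barrier_dominates:
  fixes k1 k2 p n B r m z w :: real
  assumes k: "k1 > 0" "k2 > 0" and "n \<ge> 0" "p > 2" "B > 0" "r \<ge> 0" "z \<ge> 1" "w \<ge> 0"
    and m: "m \<ge> 1" "r powr (p - 2) \<le> m"
    and B1: "4 * p \<le> B * (k1 * k2\<^sup>2)"
    and B2: "B\<^sup>2 * (4 * n + 25) + 4 * p * B^3 + 4 * p / B + k1 < k1 * B^4 / 4"
  shows "B\<^sup>2 * w\<^sup>2 + B\<^sup>2 * (4 * n + 24) * z^4 + 4 * p * B\<^sup>2 * r powr (p - 1) * z^3
    < k1 * m * ((B\<^sup>2 * (z\<^sup>2 + w) / 2 + k2 * r powr p)\<^sup>2 - 1)"
proof -
  \<comment> \<open>\<open>Y\<close> measures the squared barrier: up to the factor \<open>m\<close>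
    and powers of \<open>r\<close>, the terms to be beaten are of order B^2 Y and B^3 Y, while the
    square on the right supplies B^4 Y / 4.\<close>
  define Y where "Y = z^4 + w\<^sup>2"
  have z4: "z^4 \<ge> 1" using \<open>z \<ge> 1\<close> by simp
  then have Y: "Y \<ge> 1" "z^4 \<le> Y" "w\<^sup>2 \<le> Y" by (auto simp: Y_def intro: add_increasing2)
  have rp: "r powr (p - 1) = r powr (p - 2) * r"
    by (cases "r = 0") (use assms in \<open>auto simp: powr_diff power2_eq_square\<close>)
  have r2p: "(r powr p)\<^sup>2 = r powr (2 * p)"
    by (simp add: power2_eq_square powr_add[symmetric])
  have r4: "r^4 \<le> 1 + r powr (2 * p)"
  proof (cases "r \<le> 1")
    case True
    then show ?thesis using \<open>r \<ge> 0\<close> power_le_one[of r 4] by (simp add: add_increasing2)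
  next
    case False
    then have "r^4 = r powr 4" by simp
    also have "\<dots> \<le> r powr (2 * p)" using False \<open>p > 2\<close> by (intro powr_mono) auto
    finally show ?thesis by simp
  qed
  have sq: "B^4 * Y / 4 + k2\<^sup>2 * r powr (2 * p) \<le> (B\<^sup>2 * (z\<^sup>2 + w) / 2 + k2 * r powr p)\<^sup>2"
  proof -
    have "B^4 * Y \<le> B^4 * (z\<^sup>2 + w)\<^sup>2"
      using \<open>w \<ge> 0\<close> by (intro mult_left_mono) (auto simp: Y_def power2_sum)
    moreover have "0 \<le> B\<^sup>2 * (z\<^sup>2 + w) * k2 * r powr p" using assms by simp
    moreover have "(B\<^sup>2 * (z\<^sup>2 + w) / 2 + k2 * r powr p)\<^sup>2
        = B^4 * (z\<^sup>2 + w)\<^sup>2 / 4 + k2\<^sup>2 * (r powr p)\<^sup>2 + B\<^sup>2 * (z\<^sup>2 + w) * k2 * r powr p"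
      by (simp add: eval_nat_numeral field_simps)
    ultimately show ?thesis by (simp add: r2p)
  qed
  \<comment> \<open>The drift term: the factor \<open>r powr (p - 2)\<close> goes into
    \<open>m\<close>, the remaining \<open>r\<close> is traded for B^3 z^4 and r^4 / B, and r^4 is
    at most 1 + r^(2p) because p > 2.\<close>
  have "4 * p * B\<^sup>2 * r powr (p - 1) * z^3 = 4 * p * r powr (p - 2) * (B\<^sup>2 * (r * z^3))"
    by (simp add: rp)
  also have "\<dots> \<le> 4 * p * m * (B^3 * z^4 + r^4 / B)"
    using cross_term_bound[of r z B] assms by (intro mult_mono) auto
  also have "\<dots> \<le> 4 * p * m * (B^3 * Y + (1 + r powr (2 * p)) / B)"
    using assms r4 Y by (intro mult_left_mono add_mono divide_right_mono) auto
  finally have X: "4 * p * B\<^sup>2 * r powr (p - 1) * z^3 \<le> m * (4 * p * B^3 * Y + 4 * p / B + 4 * p / B * r powr (2 * p))"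
    by (simp add: algebra_simps add_divide_distrib)
  have Z: "B\<^sup>2 * w\<^sup>2 + B\<^sup>2 * (4 * n + 24) * z^4 \<le> m * (B\<^sup>2 * (4 * n + 25) * Y)"
  proof -
    have "B\<^sup>2 * w\<^sup>2 + B\<^sup>2 * (4 * n + 24) * z^4 \<le> B\<^sup>2 * Y + B\<^sup>2 * (4 * n + 24) * Y"
      using assms Y by (intro add_mono mult_left_mono) auto
    also have "\<dots> = 1 * (B\<^sup>2 * (4 * n + 25) * Y)" by (simp add: algebra_simps)
    also have "\<dots> \<le> m * (B\<^sup>2 * (4 * n + 25) * Y)"
      using m assms Y by (intro mult_right_mono) auto
    finally show ?thesis .
  qed
  \<comment> \<open>The first largeness condition on \<open>B\<close> lets the gradient part of the
    Hessian term absorb the r^(2p) left by the drift.\<close>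
  have "4 * p / B * r powr (2 * p) \<le> k1 * k2\<^sup>2 * r powr (2 * p)"
    using B1 \<open>B > 0\<close> by (intro mult_right_mono) (auto simp: field_simps)
  moreover have "B\<^sup>2 * (4 * n + 25) * Y + 4 * p * B^3 * Y + 4 * p / B + k1 < k1 * B^4 / 4 * Y"
  proof -
    have "B\<^sup>2 * (4 * n + 25) * Y + 4 * p * B^3 * Y + (4 * p / B + k1) * 1
       \<le> B\<^sup>2 * (4 * n + 25) * Y + 4 * p * B^3 * Y + (4 * p / B + k1) * Y"
      using assms Y by (intro add_left_mono mult_left_mono) auto
    also have "\<dots> = (B\<^sup>2 * (4 * n + 25) + 4 * p * B^3 + 4 * p / B + k1) * Y"
      by (simp add: algebra_simps)
    also have "\<dots> < k1 * B^4 / 4 * Y"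
      using B2 Y by (intro mult_strict_right_mono) auto
    finally show ?thesis by simp
  qed
  moreover have "k1 * (B^4 * Y / 4 + k2\<^sup>2 * r powr (2 * p) - 1)
      = k1 * B^4 / 4 * Y + k1 * k2\<^sup>2 * r powr (2 * p) - k1"
    by (simp add: algebra_simps)
  ultimately have "B\<^sup>2 * (4 * n + 25) * Y + (4 * p * B^3 * Y + 4 * p / B + 4 * p / B * r powr (2 * p))
      < k1 * (B^4 * Y / 4 + k2\<^sup>2 * r powr (2 * p) - 1)"
    by linarith
  also have "\<dots> \<le> k1 * ((B\<^sup>2 * (z\<^sup>2 + w) / 2 + k2 * r powr p)\<^sup>2 - 1)"
    using sq k by (intro mult_left_mono) auto
  finally have "m * (B\<^sup>2 * (4 * n + 25) * Y + (4 * p * B^3 * Y + 4 * p / B + 4 * p / B * r powr (2 * p)))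
      < m * (k1 * ((B\<^sup>2 * (z\<^sup>2 + w) / 2 + k2 * r powr p)\<^sup>2 - 1))"
    using m by (intro mult_strict_left_mono) auto
  with X Z show ?thesis by (simp add: algebra_simps)
qed

text \<open>All conditions hold for large \<open>B\<close>, since B^4 outgrows B^3 and B^2. The free
  bound \<open>C0\<close> will be 2 Ca + 2, with \<open>Ca\<close> the additive constant from
  replacing the energy by |grad u|^p.\<close>

lemma ex_barrier_constant:
  fixes k1 k2 p n C0 :: real
  assumes "k1 > 0" "k2 > 0"
  shows "\<exists>B\<ge>1. 4 * p \<le> B * (k1 * k2\<^sup>2) \<and>
    B\<^sup>2 * (4 * n + 25) + 4 * p * B^3 + 4 * p / B + k1 < k1 * B^4 / 4 \<and> C0 \<le> B\<^sup>2"
proof -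
  have "eventually (\<lambda>B. 4 * p \<le> B * (k1 * k2\<^sup>2)) at_top"
    using assms by real_asymp
  moreover have "eventually (\<lambda>B. B\<^sup>2 * (4 * n + 25) + 4 * p * B^3 + 4 * p / B + k1 < k1 * B^4 / 4) at_top"
    using assms by real_asymp
  moreover have "eventually (\<lambda>B. C0 \<le> B\<^sup>2) at_top" by real_asymp
  moreover have "eventually (\<lambda>B. (1::real) \<le> B) at_top" by real_asymp
  ultimately have "eventually (\<lambda>B. B \<ge> 1 \<and> 4 * p \<le> B * (k1 * k2\<^sup>2) \<and>
    B\<^sup>2 * (4 * n + 25) + 4 * p * B^3 + 4 * p / B + k1 < k1 * B^4 / 4 \<and> C0 \<le> B\<^sup>2) at_top"
    by eventually_elim auto
  then show ?thesis by (auto simp: eventually_at_top_linorder)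
qed

section \<open>The equation along coordinate lines and at a maximum\<close>

lemma classical_solD:
  assumes "classical_sol p R T u gu Hu ut" "x \<in> ball 0 R" "0 < t" "t < T"
  shows "((\<lambda>y. u y t) has_derivative (\<lambda>h. gu x t \<bullet> h)) (at x)"
    and "((\<lambda>y. gu y t) has_derivative Hu x t) (at x)"
    and "((\<lambda>s. u x s) has_real_derivative ut x t) (at t)"
    and "ut x t - (\<Sum>i\<in>Basis. Hu x t i \<bullet> i) = norm (gu x t) powr p"
  using assms unfolding classical_sol_def Qcyl_def by auto

lemma has_derivative_line:
  assumes "(f has_derivative f') (at (x + s *\<^sub>R k))"
  shows "((\<lambda>r. f (x + r *\<^sub>R k)) has_vector_derivative f' k) (at s)"
proof -
  have "((\<lambda>r. x + r *\<^sub>R k) has_derivative (\<lambda>r. r *\<^sub>R k)) (at s)"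
    by (auto intro!: derivative_eq_intros)
  from diff_chain_at[OF this assms] have "((\<lambda>r. f (x + r *\<^sub>R k)) has_derivative (\<lambda>r. f' (r *\<^sub>R k))) (at s)"
    by (simp add: o_def)
  then show ?thesis
    by (simp add: has_vector_derivative_def linear_cmul[OF has_derivative_linear[OF assms]])
qed

lemma classical_sol_line:
  fixes u :: "'a::euclidean_space \<Rightarrow> real \<Rightarrow> real"
  assumes "classical_sol p R T u gu Hu ut" "x + s *\<^sub>R k \<in> ball 0 R" "0 < t" "t < T"
  shows "((\<lambda>r. u (x + r *\<^sub>R k) t) has_real_derivative gu (x + s *\<^sub>R k) t \<bullet> k) (at s)"
    and "((\<lambda>r. gu (x + r *\<^sub>R k) t) has_vector_derivative Hu (x + s *\<^sub>R k) t k) (at s)"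
    and "((\<lambda>r. gu (x + r *\<^sub>R k) t \<bullet> j) has_real_derivative Hu (x + s *\<^sub>R k) t k \<bullet> j) (at s)"
proof -
  note D = classical_solD[OF assms]
  show "((\<lambda>r. u (x + r *\<^sub>R k) t) has_real_derivative gu (x + s *\<^sub>R k) t \<bullet> k) (at s)"
    using has_derivative_line[OF D(1)] by (simp add: has_real_derivative_iff_has_vector_derivative)
  show 2: "((\<lambda>r. gu (x + r *\<^sub>R k) t) has_vector_derivative Hu (x + s *\<^sub>R k) t k) (at s)"
    using has_derivative_line[OF D(2)] .
  show "((\<lambda>r. gu (x + r *\<^sub>R k) t \<bullet> j) has_real_derivative Hu (x + s *\<^sub>R k) t k \<bullet> j) (at s)"
    using bounded_linear.has_vector_derivative[OF bounded_linear_inner_left 2]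
    by (simp add: has_real_derivative_iff_has_vector_derivative)
qed

text \<open>\<open>c i\<close> and \<open>D\<close> approximate \<open>\<partial>\<^sub>iu\<close> and \<open>-u\<^sub>t\<close>; difference quotients are used because
  these functions need not be twice differentiable in space.\<close>
lemma difference_energy_max:
  fixes u :: "'a::euclidean_space \<Rightarrow> real \<Rightarrow> real"
  defines "c \<equiv> \<lambda>h i y s. (u (y + h *\<^sub>R i) s - u y s) / h"
    and "D \<equiv> \<lambda>h y s. (u y s - u y (s + h)) / h"
  assumes sol: "classical_sol p R T u gu Hu ut" and p: "p > 2" and a: "a \<ge> 0" and h: "h > 0" and e: "e > 0"
    and dom: "norm x + e + h < R" "0 < t" "t + h < T"
    and \<psi>: "\<And>k s. k \<in> Basis \<Longrightarrow> \<bar>s\<bar> < e \<Longrightarrow> ((\<lambda>r. \<psi> (x + r *\<^sub>R k) t) has_real_derivative \<psi>1 k s) (at s)"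
    and \<psi>1: "\<And>k. k \<in> Basis \<Longrightarrow> (\<psi>1 k has_real_derivative \<psi>2 k) (at 0)"
    and \<psi>t: "(\<psi> x has_real_derivative \<psi>t) (at t)"
    and maxt: "\<And>s. t - e < s \<Longrightarrow> s \<le> t \<Longrightarrow>
      a * (1 + (\<Sum>i\<in>Basis. (c h i x s)\<^sup>2)) powr (p/2) + D h x s - \<psi> x s
        \<le> a * (1 + (\<Sum>i\<in>Basis. (c h i x t)\<^sup>2)) powr (p/2) + D h x t - \<psi> x t"
    and maxx: "\<And>k s. k \<in> Basis \<Longrightarrow> \<bar>s\<bar> < e \<Longrightarrow>
      a * (1 + (\<Sum>i\<in>Basis. (c h i (x + s *\<^sub>R k) t)\<^sup>2)) powr (p/2) + D h (x + s *\<^sub>R k) t - \<psi> (x + s *\<^sub>R k) t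
        \<le> a * (1 + (\<Sum>i\<in>Basis. (c h i x t)\<^sup>2)) powr (p/2) + D h x t - \<psi> x t"
  shows "\<psi>t - (\<Sum>k\<in>Basis. \<psi>2 k) - (\<Sum>k\<in>Basis. (norm_powr_grad p (gu x t) \<bullet> k) * \<psi>1 k 0)
    \<le> a * (p * (1 + (\<Sum>i\<in>Basis. (c h i x t)\<^sup>2)) powr (p/2 - 1)) *
      ((\<Sum>i\<in>Basis. c h i x t * ((norm (gu (x + h *\<^sub>R i) t) powr p - norm (gu x t) powr p
          - norm_powr_grad p (gu x t) \<bullet> (gu (x + h *\<^sub>R i) t - gu x t)) / h))
        - (\<Sum>k\<in>Basis. \<Sum>i\<in>Basis. (((gu (x + h *\<^sub>R i) t - gu x t) \<bullet> k) / h)\<^sup>2))"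
proof -
  \<comment> \<open>\<open>P\<close> is the factor produced by differentiating the energy and
    \<open>b\<close> is the drift. \<open>dg\<close>, \<open>dH\<close>, \<open>dt\<close> are space
    quotients of the gradient, of the diagonal Hessian entries and of u_t; \<open>Dg\<close>,
    \<open>DH\<close>, \<open>Dt\<close> are their negative forward time quotients.\<close>
  define P where "P = a * (p * (1 + (\<Sum>i\<in>Basis. (c h i x t)\<^sup>2)) powr (p/2 - 1))"
  define b where "b = norm_powr_grad p (gu x t)"
  define C where "C i = c h i x t" for i
  define dg where "dg i = (gu (x + h *\<^sub>R i) t - gu x t) /\<^sub>R h" for i
  define dH where "dH i k = (Hu (x + h *\<^sub>R i) t k \<bullet> k - Hu x t k \<bullet> k) / h" for i k
  define dt where "dt i = (ut (x + h *\<^sub>R i) t - ut x t) / h" for i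
  define Dg where "Dg = (gu x t - gu x (t + h)) /\<^sub>R h"
  define DH where "DH k = (Hu x t k \<bullet> k - Hu x (t + h) k \<bullet> k) / h" for k
  define Dt where "Dt = (ut x t - ut x (t + h)) / h"
  have th: "0 < t + h" "t < T" using dom h by auto
  have x0: "x \<in> ball 0 R" using dom e h by auto
  have xi: "x + h *\<^sub>R i \<in> ball 0 R" if "i \<in> Basis" for i
  proof -
    have "norm (x + h *\<^sub>R i) \<le> norm x + h" using norm_triangle_ineq[of x "h *\<^sub>R i"] that h by simp
    then show ?thesis using dom e by auto
  qed
  have xs: "x + s *\<^sub>R k \<in> ball 0 R" if "k \<in> Basis" "\<bar>s\<bar> < e" for k s
  proof -
    have "norm (x + s *\<^sub>R k) \<le> norm x + \<bar>s\<bar>" using norm_triangle_ineq[of x "s *\<^sub>R k"] that by simp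
    then show ?thesis using dom h that by auto
  qed
  have xis: "x + h *\<^sub>R i + s *\<^sub>R k \<in> ball 0 R" if "k \<in> Basis" "\<bar>s\<bar> < e" "i \<in> Basis" for k s i
  proof -
    have "norm (x + h *\<^sub>R i + s *\<^sub>R k) \<le> norm x + h + \<bar>s\<bar>"
      using norm_triangle_ineq[of "x + h *\<^sub>R i" "s *\<^sub>R k"] norm_triangle_ineq[of x "h *\<^sub>R i"] that h by simp
    then show ?thesis using dom that by auto
  qed
  have T: "\<psi>t \<le> P * (\<Sum>i\<in>Basis. C i * dt i) + Dt"
    unfolding P_def C_def
  proof (rule energy_max_time[OF e, where c = "\<lambda>i. c h i x" and I = Basis and D = "D h x" and \<psi> = "\<psi> x"])
    show "(c h i x has_real_derivative dt i) (at t)" if "i \<in> Basis" for i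
      unfolding c_def dt_def
      by (intro DERIV_cdivide DERIV_diff classical_solD(3)[OF sol] xi that x0 dom th)
    have "((\<lambda>s. u x (s + h)) has_real_derivative ut x (t + h)) (at t)"
      using classical_solD(3)[OF sol x0 th(1) dom(3)] by (simp add: DERIV_shift)
    then show "(D h x has_real_derivative Dt) (at t)"
      unfolding D_def Dt_def by (intro DERIV_cdivide DERIV_diff classical_solD(3)[OF sol] x0 dom th)
  qed (use \<psi>t maxt in auto)
  have S: "P * (\<Sum>i\<in>Basis. C i * (dg i \<bullet> k)) + Dg \<bullet> k = \<psi>1 k 0"
    "P * (\<Sum>i\<in>Basis. (dg i \<bullet> k)\<^sup>2 + C i * dH i k) + DH k \<le> \<psi>2 k" if k: "k \<in> Basis" for k
  proof -
    define ci where "ci i s = (u (x + h *\<^sub>R i + s *\<^sub>R k) t - u (x + s *\<^sub>R k) t) / h" for i s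
    define ci1 where "ci1 i s = (gu (x + h *\<^sub>R i + s *\<^sub>R k) t \<bullet> k - gu (x + s *\<^sub>R k) t \<bullet> k) / h" for i s
    define Di where "Di s = (u (x + s *\<^sub>R k) t - u (x + s *\<^sub>R k) (t + h)) / h" for s
    define Di1 where "Di1 s = (gu (x + s *\<^sub>R k) t \<bullet> k - gu (x + s *\<^sub>R k) (t + h) \<bullet> k) / h" for s
    have ci: "c h i (x + s *\<^sub>R k) t = ci i s" for i s
      by (simp add: c_def ci_def add_ac)
    have Di: "D h (x + s *\<^sub>R k) t = Di s" for s by (simp add: D_def Di_def)
    have c0: "c h i x t = ci i 0" for i by (simp add: c_def ci_def)
    have D0: "D h x t = Di 0" by (simp add: D_def Di_def)
    have 1: "(ci i has_real_derivative ci1 i s) (at s)" if "i \<in> Basis" "\<bar>s\<bar> < e" for i s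
      unfolding ci_def ci1_def
      by (intro DERIV_cdivide DERIV_diff classical_sol_line(1)[OF sol] xs xis k that dom th)
    have 2: "(ci1 i has_real_derivative dH i k) (at 0)" if "i \<in> Basis" for i
      unfolding ci1_def dH_def
      using classical_sol_line(3)[OF sol xis[of k 0 i] dom(2) th(2), where j = k]
        classical_sol_line(3)[OF sol xs[of k 0] dom(2) th(2), where j = k] k that e
      by (intro DERIV_cdivide DERIV_diff) auto
    have 3: "(Di has_real_derivative Di1 s) (at s)" if "\<bar>s\<bar> < e" for s
      unfolding Di_def Di1_def
      by (intro DERIV_cdivide DERIV_diff classical_sol_line(1)[OF sol] xs k that dom th)
    have 4: "(Di1 has_real_derivative DH k) (at 0)"
      unfolding Di1_def DH_def
      using classical_sol_line(3)[OF sol xs[of k 0] dom(2) th(2), where j = k]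
        classical_sol_line(3)[OF sol xs[of k 0] th(1) dom(3), where j = k] k e
      by (intro DERIV_cdivide DERIV_diff) auto
    have mx: "a * (1 + (\<Sum>i\<in>Basis. (ci i s)\<^sup>2)) powr (p/2) + Di s - \<psi> (x + s *\<^sub>R k) t
        \<le> a * (1 + (\<Sum>i\<in>Basis. (ci i 0)\<^sup>2)) powr (p/2) + Di 0 - \<psi> (x + 0 *\<^sub>R k) t" if "\<bar>s\<bar> < e" for s
      using maxx[OF k that] unfolding ci Di c0 D0 by simp
    note E = energy_max_space[where I = Basis and p = p and c = ci
      and D = Di and \<psi> = "\<lambda>s. \<psi> (x + s *\<^sub>R k) t", OF e a _ 1 2 3 4 \<psi>[OF k] \<psi>1[OF k] mx]
    have g: "ci1 i 0 = dg i \<bullet> k" for i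
      by (simp add: ci1_def dg_def inner_diff_left divide_inverse mult.commute)
    have g': "Di1 0 = Dg \<bullet> k"
      by (simp add: Di1_def Dg_def inner_diff_left divide_inverse mult.commute)
    show "P * (\<Sum>i\<in>Basis. C i * (dg i \<bullet> k)) + Dg \<bullet> k = \<psi>1 k 0"
      using E(1) p unfolding P_def C_def c0 g g' by auto
    show "P * (\<Sum>i\<in>Basis. (dg i \<bullet> k)\<^sup>2 + C i * dH i k) + DH k \<le> \<psi>2 k"
      using E(2) p unfolding P_def C_def c0 g g' by auto
  qed
  \<comment> \<open>Summing the second order conditions over the coordinates produces quotients of
    the Laplacian; weighting the first order conditions with the components of \<open>b\<close> will
    produce the drift.\<close>
  have "(\<Sum>k\<in>Basis. P * (\<Sum>i\<in>Basis. (dg i \<bullet> k)\<^sup>2 + C i * dH i k) + DH k) \<le> (\<Sum>k\<in>Basis. \<psi>2 k)"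
    by (intro sum_mono S)
  moreover have "(\<Sum>k\<in>Basis. P * (\<Sum>i\<in>Basis. (dg i \<bullet> k)\<^sup>2 + C i * dH i k) + DH k)
     = P * (\<Sum>k\<in>Basis. \<Sum>i\<in>Basis. (dg i \<bullet> k)\<^sup>2) + P * (\<Sum>i\<in>Basis. C i * (\<Sum>k\<in>Basis. dH i k)) + (\<Sum>k\<in>Basis. DH k)"
    unfolding sum.distrib sum_distrib_left distrib_left
    by (subst (2) sum.swap) simp
  ultimately have S2: "P * (\<Sum>k\<in>Basis. \<Sum>i\<in>Basis. (dg i \<bullet> k)\<^sup>2) + P * (\<Sum>i\<in>Basis. C i * (\<Sum>k\<in>Basis. dH i k))
      + (\<Sum>k\<in>Basis. DH k) \<le> (\<Sum>k\<in>Basis. \<psi>2 k)" by simp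
  have "(\<Sum>k\<in>Basis. (b \<bullet> k) * \<psi>1 k 0) = (\<Sum>k\<in>Basis. (b \<bullet> k) * (P * (\<Sum>i\<in>Basis. C i * (dg i \<bullet> k)) + Dg \<bullet> k))"
    by (intro sum.cong) (auto simp: S(1))
  also have "\<dots> = P * (\<Sum>i\<in>Basis. C i * (\<Sum>k\<in>Basis. (b \<bullet> k) * (dg i \<bullet> k))) + (\<Sum>k\<in>Basis. (b \<bullet> k) * (Dg \<bullet> k))"
    unfolding sum.distrib sum_distrib_left distrib_left
    by (subst sum.swap) (simp add: mult_ac)
  also have "\<dots> = P * (\<Sum>i\<in>Basis. C i * (b \<bullet> dg i)) + b \<bullet> Dg"
    by (simp add: euclidean_inner[symmetric])
  finally have S1: "(\<Sum>k\<in>Basis. (b \<bullet> k) * \<psi>1 k 0) = P * (\<Sum>i\<in>Basis. C i * (b \<bullet> dg i)) + b \<bullet> Dg" .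
  \<comment> \<open>The difference of the equation at x + h i and at x, with the first order part of
    |q|^p moved to the left; on the right stays the convexity remainder.\<close>
  have eq_i: "dt i - (\<Sum>k\<in>Basis. dH i k) - b \<bullet> dg i = (norm (gu (x + h *\<^sub>R i) t) powr p - norm (gu x t) powr p
      - b \<bullet> (gu (x + h *\<^sub>R i) t - gu x t)) / h" if "i \<in> Basis" for i
    unfolding classical_solD(4)[OF sol xi[OF that] dom(2) th(2), symmetric] classical_solD(4)[OF sol x0 dom(2) th(2), symmetric]
    using h by (simp add: dt_def dH_def dg_def sum_subtractf sum_distrib_left inner_diff_right divide_inverse inner_scaleR_right algebra_simps)
  \<comment> \<open>The same for the time shift. The quotient is taken with a minus sign, so
    convexity gives the good sign and no smallness of \<open>h\<close> enters.\<close>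
  have "Dt - (\<Sum>k\<in>Basis. DH k) - b \<bullet> Dg = - (norm (gu x (t + h)) powr p - norm (gu x t) powr p
      - b \<bullet> (gu x (t + h) - gu x t)) / h"
    unfolding classical_solD(4)[OF sol x0 th(1) dom(3), symmetric] classical_solD(4)[OF sol x0 dom(2) th(2), symmetric]
    using h by (simp add: Dt_def DH_def Dg_def sum_subtractf sum_distrib_left inner_diff_right divide_inverse inner_scaleR_right algebra_simps)
  also have "\<dots> \<le> 0"
    using norm_powr_remainder(1)[OF p, of "gu x (t + h)" "gu x t"] h by (simp add: b_def divide_nonpos_pos)
  finally have eq_D: "Dt - (\<Sum>k\<in>Basis. DH k) - b \<bullet> Dg \<le> 0" .
  have "\<psi>t - (\<Sum>k\<in>Basis. \<psi>2 k) - (\<Sum>k\<in>Basis. (b \<bullet> k) * \<psi>1 k 0)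
    \<le> P * (\<Sum>i\<in>Basis. C i * (dt i - (\<Sum>k\<in>Basis. dH i k) - b \<bullet> dg i)) - P * (\<Sum>k\<in>Basis. \<Sum>i\<in>Basis. (dg i \<bullet> k)\<^sup>2)"
    using T S2 eq_D unfolding S1
    by (simp add: right_diff_distrib sum_subtractf)
  also have "(\<Sum>i\<in>Basis. C i * (dt i - (\<Sum>k\<in>Basis. dH i k) - b \<bullet> dg i))
     = (\<Sum>i\<in>Basis. c h i x t * ((norm (gu (x + h *\<^sub>R i) t) powr p - norm (gu x t) powr p
      - b \<bullet> (gu (x + h *\<^sub>R i) t - gu x t)) / h))"
    by (intro sum.cong) (auto simp: eq_i C_def)
  also have "(\<Sum>k\<in>Basis. \<Sum>i\<in>Basis. (dg i \<bullet> k)\<^sup>2) = (\<Sum>k\<in>Basis. \<Sum>i\<in>Basis. (((gu (x + h *\<^sub>R i) t - gu x t) \<bullet> k) / h)\<^sup>2)"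
    by (simp add: dg_def divide_inverse mult.commute)
  finally show ?thesis unfolding P_def b_def by (simp add: right_diff_distrib)
qed

section \<open>Derivatives of the barrier and uniform approximation\<close>

text \<open>Along a coordinate direction k the function d has derivative -2 x_k, so d^(-2) has
  derivatives 4 x_k / d^3 and 4 / d^3 + 24 x_k^2 / d^4. Summed over k, the latter leads to the
  coefficient 4 n + 24.\<close>

lemma barrier_derivatives:
  fixes x k :: "'a::euclidean_space" and A t1 t :: real
  defines "d \<equiv> \<lambda>y::'a. 9/16 - y \<bullet> y"
  defines "\<psi> \<equiv> \<lambda>y t. A * (1 / (d y)\<^sup>2 + 1 / (t - t1))"
  defines "\<psi>1 \<equiv> \<lambda>k s. A * (4 * ((x + s *\<^sub>R k) \<bullet> k) / d (x + s *\<^sub>R k) ^ 3)"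
  shows "k \<in> Basis \<Longrightarrow> d (x + s *\<^sub>R k) \<noteq> 0 \<Longrightarrow>
      ((\<lambda>r. \<psi> (x + r *\<^sub>R k) t) has_real_derivative \<psi>1 k s) (at s)"
    and "k \<in> Basis \<Longrightarrow> d x \<noteq> 0 \<Longrightarrow>
      (\<psi>1 k has_real_derivative A * (4 / d x ^ 3 + 24 * (x \<bullet> k)\<^sup>2 / d x ^ 4)) (at 0)"
    and "t \<noteq> t1 \<Longrightarrow> (\<psi> x has_real_derivative - A / (t - t1)\<^sup>2) (at t)"
proof -
  have d: "((\<lambda>r. d (x + r *\<^sub>R k)) has_real_derivative - 2 * ((x + s *\<^sub>R k) \<bullet> k)) (at s)" for s k
    unfolding d_def has_real_derivative_iff_has_vector_derivative has_vector_derivative_def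
    by (auto intro!: derivative_eq_intros simp: inner_commute algebra_simps)
  have l: "((\<lambda>r. (x + r *\<^sub>R k) \<bullet> k) has_real_derivative k \<bullet> k) (at s)" for s
    unfolding has_real_derivative_iff_has_vector_derivative has_vector_derivative_def
    by (auto intro!: derivative_eq_intros)
  show "((\<lambda>r. \<psi> (x + r *\<^sub>R k) t) has_real_derivative \<psi>1 k s) (at s)" if "d (x + s *\<^sub>R k) \<noteq> 0"
    unfolding \<psi>_def \<psi>1_def using that
    by (auto intro!: derivative_eq_intros d simp: eval_nat_numeral)
  show "(\<psi>1 k has_real_derivative A * (4 / d x ^ 3 + 24 * (x \<bullet> k)\<^sup>2 / d x ^ 4)) (at 0)"
    if "k \<in> Basis" "d x \<noteq> 0"
    unfolding \<psi>1_def using that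
    by (auto intro!: derivative_eq_intros d l simp: eval_nat_numeral field_simps)
  show "(\<psi> x has_real_derivative - A / (t - t1)\<^sup>2) (at t)" if "t \<noteq> t1"
    unfolding \<psi>_def using that
    by (auto intro!: derivative_eq_intros simp: eval_nat_numeral)
qed

text \<open>The energy is asymptotic to r^p and a is strictly below (1 + a) / 2, so the inequality
  holds for large r and a constant covers the rest. The shift r + 1 leaves space for the error
  between the gradient and its quotients.\<close>

lemma energy_absorb:
  fixes a p :: real
  assumes a: "0 < a" "a < 1" and p: "p > 2"
  shows "\<exists>C\<ge>0. \<forall>r\<ge>0. a * (1 + (r + 1)\<^sup>2) powr (p/2) \<le> (1 + a) / 2 * r powr p + C"
proof -
  have "((\<lambda>r::real. (1 + (r + 1)\<^sup>2) powr (p/2) / r powr p) \<longlongrightarrow> 1) at_top"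
    using p by real_asymp
  moreover have "1 < (1 + a) / (2 * a)" using a by (simp add: field_simps)
  ultimately have "eventually (\<lambda>r::real. (1 + (r + 1)\<^sup>2) powr (p/2) / r powr p < (1 + a) / (2 * a)) at_top"
    by (rule order_tendstoD)
  then obtain N where N: "\<And>r. r \<ge> N \<Longrightarrow> (1 + (r + 1)\<^sup>2) powr (p/2) / r powr p < (1 + a) / (2 * a)"
    by (auto simp: eventually_at_top_linorder)
  \<comment> \<open>The lower bound 1 makes r positive, so that the quotient by
    \<open>r powr p\<close> can be cleared.\<close>
  define N' where "N' = max N 1"
  show ?thesis
  proof (intro exI[of _ "a * (1 + (N' + 1)\<^sup>2) powr (p/2)"] conjI allI impI)
    fix r :: real assume r: "r \<ge> 0"
    show "a * (1 + (r + 1)\<^sup>2) powr (p/2) \<le> (1 + a) / 2 * r powr p + a * (1 + (N' + 1)\<^sup>2) powr (p/2)"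
    proof (cases "r \<ge> N'")
      case True
      then have "r > 0" by (simp add: N'_def)
      with N[of r] True have "a * (1 + (r + 1)\<^sup>2) powr (p/2) \<le> (1 + a) / 2 * r powr p"
        using a by (simp add: N'_def field_simps)
      moreover have "0 \<le> a * (1 + (N' + 1)\<^sup>2) powr (p/2)" using a by simp
      ultimately show ?thesis by linarith
    next
      case False
      then have "a * (1 + (r + 1)\<^sup>2) powr (p/2) \<le> a * (1 + (N' + 1)\<^sup>2) powr (p/2)"
        using a p r by (intro mult_left_mono powr_mono2 add_left_mono power_mono) auto
      moreover have "0 \<le> (1 + a) / 2 * r powr p" using a by simp
      ultimately show ?thesis by linarith
    qed
  qed (use a in auto)
qed

text \<open>The version for merely continuous functions. It is meant for
  \<open>norm_powr_grad p\<close> of the gradient, whose variation bounds the convexity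
  remainder.\<close>

lemma shift_uniform:
  fixes G :: "'b::real_normed_vector \<Rightarrow> 'c::real_normed_vector"
  assumes K: "compact K" and G: "continuous_on K G" and h1: "h1 > 0" and eps: "eps > 0"
    and seg: "\<And>z s. z \<in> Z \<Longrightarrow> 0 \<le> s \<Longrightarrow> s \<le> h1 \<Longrightarrow> z + s *\<^sub>R v \<in> K"
  shows "eventually (\<lambda>h. \<forall>z\<in>Z. norm (G (z + h *\<^sub>R v) - G z) \<le> eps) (at_right 0)"
proof -
  have "uniformly_continuous_on K G" using K G by (rule compact_uniformly_continuous[rotated])
  then obtain d where d: "d > 0" "\<And>x y. x \<in> K \<Longrightarrow> y \<in> K \<Longrightarrow> dist x y < d \<Longrightarrow> dist (G x) (G y) < eps"
    unfolding uniformly_continuous_on_def using eps by metis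
  have pos: "norm v + 1 > 0" using norm_ge_zero[of v] by linarith
  show ?thesis
    unfolding eventually_at_right_field
  proof (intro exI[of _ "min h1 (d / (norm v + 1))"] conjI allI impI ballI)
    fix h z assume h: "0 < h" "h < min h1 (d / (norm v + 1))" and z: "z \<in> Z"
    have "h * norm v \<le> h * (norm v + 1)" using h by (intro mult_left_mono) auto
    also have "\<dots> < d" using h pos by (auto simp: field_simps)
    finally have "dist (z + h *\<^sub>R v) z < d" using h by (simp add: dist_norm)
    moreover have "z + h *\<^sub>R v \<in> K" "z \<in> K" using seg[OF z, of h] seg[OF z, of 0] h h1 by auto
    ultimately show "norm (G (z + h *\<^sub>R v) - G z) \<le> eps"
      using d(2) by (fastforce simp: dist_norm)
  qed (use h1 d pos in auto)
qed

text \<open>The last of the four approximations is the delicate one. The remainder is at most the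
  variation of \<open>norm_powr_grad\<close> times that of grad u; the first tends to 0 uniformly,
  the second is O(h) because the Hessian is bounded on compact sets.\<close>

lemma classical_sol_difference_quotients:
  fixes u :: "'a::euclidean_space \<Rightarrow> real \<Rightarrow> real"
  assumes sol: "classical_sol p 1 T u gu Hu ut" and p: "p > 2" and t: "0 < t1" "t1 \<le> t0" "t0 < T" and eps: "eps > 0"
  shows "eventually (\<lambda>h. \<forall>x\<in>cball 0 (3/4). \<forall>t\<in>{t1..t0}.
    (\<forall>i\<in>Basis. \<bar>(u (x + h *\<^sub>R i) t - u x t) / h - gu x t \<bullet> i\<bar> \<le> eps) \<and>
    \<bar>(u x t - u x (t + h)) / h + ut x t\<bar> \<le> eps \<and>
    \<bar>(\<Sum>k\<in>Basis. ((gu (x + h *\<^sub>R k) t - gu x t) \<bullet> k) / h) - (\<Sum>k\<in>Basis. Hu x t k \<bullet> k)\<bar> \<le> eps \<and>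
    (\<forall>i\<in>Basis. \<bar>(norm (gu (x + h *\<^sub>R i) t) powr p - norm (gu x t) powr p
          - norm_powr_grad p (gu x t) \<bullet> (gu (x + h *\<^sub>R i) t - gu x t)) / h\<bar> \<le> eps)) (at_right 0)"
proof -
  \<comment> \<open>Shifts need room inside the cylinder: the midpoint of t0 and T provides it in
    time, the gap 7/8 - 3/4 = 1/8 in space.\<close>
  define t2 where "t2 = (t0 + T) / 2"
  define h1 where "h1 = min (1/8) (t2 - t0)"
  define K where "K = cball (0::'a) (7/8) \<times> {t1..t2}"
  define Z where "Z = cball (0::'a) (3/4) \<times> {t1..t0}"
  have K: "compact K" unfolding K_def by (intro compact_Times) auto
  have KQ: "K \<subseteq> Qcyl 1 T" using t by (auto simp: K_def Qcyl_def t2_def)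
  have h1: "h1 > 0" using t by (auto simp: h1_def t2_def)
  have segx: "z + s *\<^sub>R (i, 0) \<in> K" if "z \<in> Z" "0 \<le> s" "s \<le> h1" "i \<in> Basis" for z s i
  proof -
    have "norm (fst z + s *\<^sub>R i) \<le> norm (fst z) + s"
      using norm_triangle_ineq[of "fst z" "s *\<^sub>R i"] that by simp
    then show ?thesis using that t by (auto simp: K_def Z_def h1_def t2_def)
  qed
  have segt: "z + s *\<^sub>R (0, 1) \<in> K" if "z \<in> Z" "0 \<le> s" "s \<le> h1" for z s
    using that t by (auto simp: K_def Z_def h1_def)
  have cont: "continuous_on K (\<lambda>z. gu (fst z) (snd z))" "continuous_on K (\<lambda>z. ut (fst z) (snd z))"
    "\<And>i. i \<in> Basis \<Longrightarrow> continuous_on K (\<lambda>z. Hu (fst z) (snd z) i)"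
    using sol KQ unfolding classical_sol_def by (auto simp: case_prod_unfold intro: continuous_on_subset)
  have inK: "x \<in> ball 0 1" "0 < t" "t < T" if "(x, t) \<in> K" for x t
    using that KQ by (auto simp: Qcyl_def)
  define n where "n = real DIM('a)"
  have n: "n > 0" by (simp add: n_def)
  have all: "eventually (\<lambda>h. \<forall>i\<in>Basis. P i h) (at_right 0)"
    if "\<And>i. i \<in> Basis \<Longrightarrow> eventually (P i) (at_right 0)" for P :: "'a \<Rightarrow> real \<Rightarrow> bool"
    using that by (simp add: eventually_ball_finite)
  have E1: "eventually (\<lambda>h. \<forall>i\<in>Basis. \<forall>z\<in>Z. norm (((\<lambda>z. u (fst z) (snd z)) (z + h *\<^sub>R (i, 0)) - u (fst z) (snd z)) /\<^sub>R h
      - gu (fst z) (snd z) \<bullet> i) \<le> eps) (at_right 0)"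
  proof (rule all, goal_cases)
    case i: (1 i)
    show ?case
    proof (rule difference_quotient_uniform[OF K _ h1 eps])
      show "continuous_on K (\<lambda>z. gu (fst z) (snd z) \<bullet> i)" by (intro continuous_intros cont)
      fix z :: "'a \<times> real" and s assume z: "z \<in> Z" "0 \<le> s" "s \<le> h1"
      from segx[OF z i] inK[of "fst z + s *\<^sub>R i" "snd z"]
      show "((\<lambda>r. u (fst (z + r *\<^sub>R (i, 0))) (snd (z + r *\<^sub>R (i, 0)))) has_vector_derivative
          gu (fst (z + s *\<^sub>R (i, 0))) (snd (z + s *\<^sub>R (i, 0))) \<bullet> i) (at s)"
        using classical_sol_line(1)[OF sol, of "fst z" s i "snd z"]
        by (cases z) (auto simp: has_real_derivative_iff_has_vector_derivative)
    qed (use segx i in auto)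
  qed
  have E2: "eventually (\<lambda>h. \<forall>z\<in>Z. norm (((\<lambda>z. u (fst z) (snd z)) (z + h *\<^sub>R (0, 1)) - u (fst z) (snd z)) /\<^sub>R h
      - ut (fst z) (snd z)) \<le> eps) (at_right 0)"
  proof (rule difference_quotient_uniform[OF K cont(2) h1 eps])
    fix z :: "'a \<times> real" and s assume z: "z \<in> Z" "0 \<le> s" "s \<le> h1"
    from segt[OF z] inK[of "fst z" "snd z + s"]
    have "(u (fst z) has_real_derivative ut (fst z) (snd z + s)) (at (s + snd z))"
      using classical_solD(3)[OF sol, of "fst z" "snd z + s"] by (cases z) (auto simp: add.commute)
    then have "((\<lambda>r. u (fst z) (snd z + r)) has_real_derivative ut (fst z) (snd z + s)) (at s)"
      unfolding DERIV_shift by (simp add: add.commute)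
    then show "((\<lambda>r. u (fst (z + r *\<^sub>R (0, 1))) (snd (z + r *\<^sub>R (0, 1)))) has_vector_derivative
        ut (fst (z + s *\<^sub>R (0, 1))) (snd (z + s *\<^sub>R (0, 1)))) (at s)"
      by (cases z) (auto simp: has_real_derivative_iff_has_vector_derivative)
  qed (use segt in auto)
  have E3: "eventually (\<lambda>h. \<forall>i\<in>Basis. \<forall>z\<in>Z. norm (((\<lambda>z. gu (fst z) (snd z)) (z + h *\<^sub>R (i, 0)) - gu (fst z) (snd z)) /\<^sub>R h
      - Hu (fst z) (snd z) i) \<le> e) (at_right 0)" if e: "e > 0" for e
  proof (rule all, goal_cases)
    case i: (1 i)
    show ?case
    proof (rule difference_quotient_uniform[OF K cont(3)[OF i] h1 e])
      fix z :: "'a \<times> real" and s assume z: "z \<in> Z" "0 \<le> s" "s \<le> h1"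
      from segx[OF z i] inK[of "fst z + s *\<^sub>R i" "snd z"]
      show "((\<lambda>r. gu (fst (z + r *\<^sub>R (i, 0))) (snd (z + r *\<^sub>R (i, 0)))) has_vector_derivative
          Hu (fst (z + s *\<^sub>R (i, 0))) (snd (z + s *\<^sub>R (i, 0))) i) (at s)"
        using classical_sol_line(2)[OF sol, of "fst z" s i "snd z"]
        by (cases z) auto
    qed (use segx i in auto)
  qed
  have "\<exists>M>0. \<forall>i\<in>Basis. \<forall>z\<in>K. norm (Hu (fst z) (snd z) i) \<le> M"
  proof -
    have "\<exists>M. \<forall>z\<in>K. norm (Hu (fst z) (snd z) i) \<le> M" if "i \<in> Basis" for i
      using compact_imp_bounded[OF compact_continuous_image[OF cont(3)[OF that] K]]
      by (auto simp: bounded_iff)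
    then obtain M where M: "\<And>i z. i \<in> Basis \<Longrightarrow> z \<in> K \<Longrightarrow> norm (Hu (fst z) (snd z) i) \<le> M i" by metis
    show ?thesis
    proof (intro exI[of _ "1 + (\<Sum>i\<in>Basis. \<bar>M i\<bar>)"] conjI ballI)
      fix i :: 'a and z assume i: "i \<in> Basis" "z \<in> K"
      have "\<bar>M i\<bar> \<le> (\<Sum>i\<in>Basis. \<bar>M i\<bar>)" using i by (intro member_le_sum) auto
      then show "norm (Hu (fst z) (snd z) i) \<le> 1 + (\<Sum>i\<in>Basis. \<bar>M i\<bar>)" using M[OF i] by linarith
    qed (intro add_pos_nonneg sum_nonneg, auto)
  qed
  then obtain M where M: "M > 0" "\<And>i z. i \<in> Basis \<Longrightarrow> z \<in> K \<Longrightarrow> norm (Hu (fst z) (snd z) i) \<le> M" by blast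
  \<comment> \<open>The tolerance is divided by M + 1 because the gradient will change by at most h
    (M + 1).\<close>
  have E4: "eventually (\<lambda>h. \<forall>i\<in>Basis. \<forall>z\<in>Z. norm ((\<lambda>z. norm_powr_grad p (gu (fst z) (snd z))) (z + h *\<^sub>R (i, 0))
      - norm_powr_grad p (gu (fst z) (snd z))) \<le> eps / (M + 1)) (at_right 0)"
  proof (rule all, goal_cases)
    case i: (1 i)
    show ?case
    proof (rule shift_uniform[OF K _ h1])
      show "continuous_on K (\<lambda>z. norm_powr_grad p (gu (fst z) (snd z)))"
        using continuous_on_compose2[OF continuous_on_norm_powr_grad[OF p] cont(1)] by auto
    qed (use segx i M eps in auto)
  qed
  have "eventually (\<lambda>h::real. h > 0) (at_right 0)" by (simp add: eventually_at_right_less)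
  \<comment> \<open>The gradient quotients are used at two accuracies: error 1 bounds their size by
    M + 1, and error eps / n makes the trace accurate to \<open>eps\<close>.\<close>
  with E1 E2 E3[OF zero_less_one] E3[OF divide_pos_pos[OF eps n]] E4 show ?thesis
  proof eventually_elim
    case (elim h)
    show ?case
    proof (intro ballI conjI)
      fix x t assume x: "x \<in> cball (0::'a) (3/4)" and t: "t \<in> {t1..t0}"
      then have z: "(x, t) \<in> Z" by (auto simp: Z_def)
      then have zK: "(x, t) \<in> K" using segt[of "(x,t)" 0] h1 by auto
      show "\<bar>(u (x + h *\<^sub>R i) t - u x t) / h - gu x t \<bullet> i\<bar> \<le> eps" if "i \<in> Basis" for i
        using elim(1) that z by (force simp: divide_inverse mult.commute)
      have "\<bar>(u x (t + h) - u x t) / h - ut x t\<bar> \<le> eps"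
        using elim(2) z by (force simp: divide_inverse mult.commute)
      then show "\<bar>(u x t - u x (t + h)) / h + ut x t\<bar> \<le> eps"
        by (simp add: diff_divide_distrib abs_le_iff)
      define dg where "dg i = (gu (x + h *\<^sub>R i) t - gu x t) /\<^sub>R h" for i
      have dg: "norm (dg i - Hu x t i) \<le> 1" "norm (dg i - Hu x t i) \<le> eps / n" if "i \<in> Basis" for i
        using elim(3,4) z that eps n by (force simp: dg_def)+
      have "(\<Sum>k\<in>Basis. ((gu (x + h *\<^sub>R k) t - gu x t) \<bullet> k) / h) - (\<Sum>k\<in>Basis. Hu x t k \<bullet> k)
         = (\<Sum>k\<in>Basis. (dg k - Hu x t k) \<bullet> k)"
        by (simp add: dg_def sum_subtractf inner_diff_left divide_inverse mult.commute)
      also have "\<bar>\<dots>\<bar> \<le> (\<Sum>k\<in>(Basis::'a set). eps / n)"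
      proof (rule order_trans[OF sum_abs sum_mono])
        fix k :: 'a assume k: "k \<in> Basis"
        show "\<bar>(dg k - Hu x t k) \<bullet> k\<bar> \<le> eps / n"
          using Basis_le_norm[OF k, of "dg k - Hu x t k"] dg(2)[OF k] by linarith
      qed
      also have "\<dots> = eps" using n by (simp add: n_def)
      finally show "\<bar>(\<Sum>k\<in>Basis. ((gu (x + h *\<^sub>R k) t - gu x t) \<bullet> k) / h) - (\<Sum>k\<in>Basis. Hu x t k \<bullet> k)\<bar> \<le> eps" .
      fix i :: 'a assume i: "i \<in> Basis"
      have "norm (dg i) \<le> norm (dg i - Hu x t i) + norm (Hu x t i)"
        using norm_triangle_ineq[of "dg i - Hu x t i" "Hu x t i"] by simp
      also have "\<dots> \<le> 1 + M" using dg(1)[OF i] M(2)[OF i zK] by simp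
      finally have dgM: "norm (dg i) \<le> M + 1" by simp
      have diff: "gu (x + h *\<^sub>R i) t - gu x t = h *\<^sub>R dg i" using elim by (simp add: dg_def)
      define rem where "rem = norm (gu (x + h *\<^sub>R i) t) powr p - norm (gu x t) powr p
          - norm_powr_grad p (gu x t) \<bullet> (gu (x + h *\<^sub>R i) t - gu x t)"
      have "rem \<le> norm (norm_powr_grad p (gu (x + h *\<^sub>R i) t) - norm_powr_grad p (gu x t)) * norm (gu (x + h *\<^sub>R i) t - gu x t)"
        unfolding rem_def by (rule norm_powr_remainder(2)[OF p])
      also have "\<dots> \<le> eps / (M + 1) * (h * (M + 1))"
        using elim(5,6) z i dgM M eps unfolding diff by (intro mult_mono) force+
      also have "\<dots> = h * eps" using M by simp
      finally have "rem / h \<le> eps" using elim by (simp add: field_simps)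
      moreover have "rem \<ge> 0" unfolding rem_def by (rule norm_powr_remainder(1)[OF p])
      ultimately show "\<bar>rem / h\<bar> \<le> eps"
        using elim by simp
    qed
  qed
qed

section \<open>The estimate on the unit cylinder\<close>

lemma norm_sum_Basis_squared:
  fixes f :: "'a::euclidean_space \<Rightarrow> real"
  shows "(norm (\<Sum>i\<in>Basis. f i *\<^sub>R i))\<^sup>2 = (\<Sum>i\<in>Basis. (f i)\<^sup>2)"
  by (simp add: norm_eq_sqrt_inner euclidean_inner[where x = "\<Sum>i\<in>Basis. f i *\<^sub>R i" and y = "\<Sum>i\<in>Basis. f i *\<^sub>R i"]
      sum_nonneg power2_eq_square)

lemma norm_coordinates_close:
  fixes f :: "'a::euclidean_space \<Rightarrow> real"
  assumes "\<And>i. i \<in> Basis \<Longrightarrow> \<bar>f i - q \<bullet> i\<bar> \<le> eps"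
  shows "\<bar>norm (\<Sum>i\<in>Basis. f i *\<^sub>R i) - norm q\<bar> \<le> real DIM('a) * eps"
proof -
  define v where "v = (\<Sum>i\<in>Basis. f i *\<^sub>R i)"
  have "norm (v - q) \<le> (\<Sum>i\<in>Basis. \<bar>(v - q) \<bullet> i\<bar>)" by (rule norm_le_l1)
  also have "\<dots> \<le> (\<Sum>i\<in>(Basis::'a set). eps)"
    by (intro sum_mono) (use assms in \<open>auto simp: v_def inner_diff_left\<close>)
  finally have "norm (v - q) \<le> real DIM('a) * eps" by simp
  with norm_triangle_ineq3[of v q] show ?thesis by (simp add: v_def)
qed

text \<open>Cauchy-Schwarz on the diagonal, after which the off-diagonal squares are added. This
  turns the Hessian term into the square of the Laplacian.\<close>

lemma trace_squared_le:
  fixes g :: "'a::euclidean_space \<Rightarrow> 'a \<Rightarrow> real"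
  shows "(\<Sum>k\<in>Basis. g k k)\<^sup>2 / real DIM('a) \<le> (\<Sum>k\<in>Basis. \<Sum>i\<in>Basis. (g i k)\<^sup>2)"
proof -
  have "(\<Sum>k\<in>(Basis::'a set). g k k)\<^sup>2 \<le> (\<Sum>k\<in>Basis. (g k k)\<^sup>2) * real DIM('a)"
    by (rule sum_squared_le_sum_of_squares)
  moreover have "(\<Sum>k\<in>(Basis::'a set). (g k k)\<^sup>2) \<le> (\<Sum>k\<in>Basis. \<Sum>i\<in>Basis. (g i k)\<^sup>2)"
    by (intro sum_mono member_le_sum) auto
  ultimately have "(\<Sum>k\<in>(Basis::'a set). g k k)\<^sup>2 \<le> (\<Sum>k\<in>Basis. \<Sum>i\<in>Basis. (g i k)\<^sup>2) * real DIM('a)"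
    by (meson mult_right_mono of_nat_0_le_iff order_trans)
  then show ?thesis by (simp add: divide_le_eq)
qed

text \<open>Where the function exceeds the barrier, the equation makes minus the discrete Laplacian
  at least X >= 1, so the Hessian term is at least X^2 / n. The conditions at the maximum then bound
  k1 m (X^2 - 1) by derivatives of the barrier, which contradicts the choice of
  \<open>B\<close>.\<close>

lemma barrier_no_interior_max:
  fixes u :: "'a::euclidean_space \<Rightarrow> real \<Rightarrow> real"
  defines "n \<equiv> real DIM('a)"
  defines "c \<equiv> \<lambda>h i y s. (u (y + h *\<^sub>R i) s - u y s) / h"
    and "D \<equiv> \<lambda>h y s. (u y s - u y (s + h)) / h"
  defines "w \<equiv> \<lambda>a p h y s. a * (1 + (\<Sum>i\<in>Basis. (c h i y s)\<^sup>2)) powr (p/2) + D h y s"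
    and "\<psi> \<equiv> \<lambda>B t1 (y::'a) s. B\<^sup>2 * (1 / (9/16 - y \<bullet> y)\<^sup>2 + 1 / (s - t1))"
  assumes sol: "classical_sol p 1 T u gu Hu ut" and p: "p > 2" and a: "0 < a" "a < 1" and h: "h > 0" and e: "e > 0"
    and dom: "norm x + e + h < 1" "0 < t" "t + h < T"
    and int: "t1 < t" "\<And>y. norm (y - x) < e \<Longrightarrow> y \<bullet> y < 9/16"
    and maxt: "\<And>s. t - e < s \<Longrightarrow> s \<le> t \<Longrightarrow> w a p h x s - \<psi> B t1 x s \<le> w a p h x t - \<psi> B t1 x t"
    and maxx: "\<And>y. norm (y - x) < e \<Longrightarrow> w a p h y t - \<psi> B t1 y t \<le> w a p h x t - \<psi> B t1 x t"
    and pos: "\<psi> B t1 x t < w a p h x t"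
    and Ca: "\<And>r. r \<ge> 0 \<Longrightarrow> a * (1 + (r + 1)\<^sup>2) powr (p/2) \<le> (1 + a) / 2 * r powr p + Ca" "Ca \<ge> 0"
    and B: "B \<ge> 1" "2 * Ca + 2 \<le> B\<^sup>2" "4 * p \<le> B * (a * p * (1/2) powr (p/2 - 1) / n * ((1 - a) / 2)\<^sup>2)"
      "B\<^sup>2 * (4 * n + 25) + 4 * p * B^3 + 4 * p / B + a * p * (1/2) powr (p/2 - 1) / n
        < a * p * (1/2) powr (p/2 - 1) / n * B^4 / 4"
    and M: "norm (gu x t) \<le> M"
    and eps: "eps \<ge> 0" "eps \<le> 1/4" "n * eps \<le> 1/4" "n * ((M + 1) * eps) \<le> 1 / n"
    and E1: "\<And>i. i \<in> Basis \<Longrightarrow> \<bar>c h i x t - gu x t \<bullet> i\<bar> \<le> eps"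
    and E2: "\<bar>D h x t + ut x t\<bar> \<le> eps"
    and E3: "\<bar>(\<Sum>k\<in>Basis. ((gu (x + h *\<^sub>R k) t - gu x t) \<bullet> k) / h) - (\<Sum>k\<in>Basis. Hu x t k \<bullet> k)\<bar> \<le> eps"
    and E4: "\<And>i. i \<in> Basis \<Longrightarrow> \<bar>(norm (gu (x + h *\<^sub>R i) t) powr p - norm (gu x t) powr p
          - norm_powr_grad p (gu x t) \<bullet> (gu (x + h *\<^sub>R i) t - gu x t)) / h\<bar> \<le> eps"
  shows False
proof -
  define d where "d = 9/16 - x \<bullet> x"
  define z where "z = 1 / d"
  define \<tau> where "\<tau> = 1 / (t - t1)"
  define q where "q = gu x t"
  define r where "r = norm q"
  define cv where "cv = (\<Sum>i\<in>Basis. c h i x t *\<^sub>R i)"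
  define s where "s = norm cv"
  define \<rho> where "\<rho> i = (norm (gu (x + h *\<^sub>R i) t) powr p - norm (gu x t) powr p
          - norm_powr_grad p (gu x t) \<bullet> (gu (x + h *\<^sub>R i) t - gu x t)) / h" for i
  define g where "g i k = ((gu (x + h *\<^sub>R i) t - gu x t) \<bullet> k) / h" for i k
  define m where "m = (1 + r\<^sup>2) powr (p/2 - 1)"
  define k1 where "k1 = a * p * (1/2) powr (p/2 - 1) / n"
  \<comment> \<open>Half of the barrier is kept; the other half, at least Ca + 1, pays for the
    additive constant and the approximation errors.\<close>
  define X where "X = B\<^sup>2 * (z\<^sup>2 + \<tau>) / 2 + (1 - a) / 2 * r powr p"
  have n: "n \<ge> 1" unfolding n_def by (simp add: Suc_leI)
  have k1: "k1 > 0" using a p n by (simp add: k1_def)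
  have d: "0 < d" "d \<le> 9/16" using int(2)[of x] e by (auto simp: d_def)
  have z: "z \<ge> 1" using d by (simp add: z_def)
  have \<tau>: "\<tau> \<ge> 0" using int(1) by (simp add: \<tau>_def)
  have \<psi>: "\<psi> B t1 x t = B\<^sup>2 * (z\<^sup>2 + \<tau>)"
    by (simp add: \<psi>_def z_def \<tau>_def d_def power_one_over)
  have s2: "s\<^sup>2 = (\<Sum>i\<in>Basis. (c h i x t)\<^sup>2)"
    unfolding s_def cv_def by (rule norm_sum_Basis_squared)
  have "\<bar>s - r\<bar> \<le> n * eps"
    unfolding s_def cv_def r_def q_def n_def by (rule norm_coordinates_close) (rule E1)
  then have sr: "s \<le> r + 1/4" "r \<le> s + 1/4" using eps(3) by linarith+
  have r0: "r \<ge> 0" "s \<ge> 0" by (simp_all add: r_def s_def)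
  \<comment> \<open>Comparing the energy of the quotients with that of the true gradient costs a
    factor 2, which is the origin of \<open>(1/2) powr (p/2 - 1)\<close> in
    \<open>k1\<close>.\<close>
  have s_r: "(1 + r\<^sup>2) / 2 \<le> 1 + s\<^sup>2"
  proof -
    have "r\<^sup>2 \<le> (s + 1/4)\<^sup>2" using sr r0 by (intro power_mono) auto
    moreover have "0 \<le> (s - 1/4)\<^sup>2" by simp
    ultimately show ?thesis by (simp add: power2_eq_square algebra_simps)
  qed
  have m1: "m \<ge> 1" unfolding m_def using p by (intro ge_one_powr_ge_zero) auto
  have m2: "r powr (p - 2) \<le> m"
  proof (cases "r = 0")
    case False
    then have "r\<^sup>2 = r powr 2" using r0 by simp
    moreover have "(r powr 2) powr (p/2 - 1) = r powr (p - 2)"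
      unfolding powr_powr by (simp add: right_diff_distrib)
    ultimately have "r powr (p - 2) = (r\<^sup>2) powr (p/2 - 1)" by (simp only:)
    also have "\<dots> \<le> m" unfolding m_def using p by (intro powr_mono2) auto
    finally show ?thesis .
  qed (use m1 in simp)
  have mc: "(1/2) powr (p/2 - 1) * m \<le> (1 + s\<^sup>2) powr (p/2 - 1)"
  proof -
    have "(1/2) powr (p/2 - 1) * m = ((1 + r\<^sup>2) / 2) powr (p/2 - 1)"
      by (simp add: m_def powr_divide)
    also have "\<dots> \<le> (1 + s\<^sup>2) powr (p/2 - 1)" using p s_r by (intro powr_mono2) auto
    finally show ?thesis .
  qed
  have absorb: "a * (1 + s\<^sup>2) powr (p/2) \<le> (1 + a) / 2 * r powr p + Ca"
  proof -
    have "a * (1 + s\<^sup>2) powr (p/2) \<le> a * (1 + (r + 1)\<^sup>2) powr (p/2)"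
      using a p sr r0 by (intro mult_left_mono powr_mono2 add_left_mono power_mono) auto
    with Ca(1)[OF r0(1)] show ?thesis by linarith
  qed
  have X2: "X \<ge> 1" "Ca + 1 \<le> B\<^sup>2 * (z\<^sup>2 + \<tau>) / 2"
  proof -
    have "B\<^sup>2 * 1 \<le> B\<^sup>2 * (z\<^sup>2 + \<tau>)" using z \<tau> by (intro mult_left_mono) (auto simp: add_increasing2)
    then show "Ca + 1 \<le> B\<^sup>2 * (z\<^sup>2 + \<tau>) / 2" using B(2) by simp
    moreover have "0 \<le> (1 - a) / 2 * r powr p" using a by simp
    ultimately show "X \<ge> 1" unfolding X_def using Ca(2) by linarith
  qed
  have x0: "x \<in> ball 0 1" "t < T" using dom e h by auto
  \<comment> \<open>By the equation, minus the Laplacian is r^p - u_t. Here -u_t is \<open>D\<close>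
    up to \<open>eps\<close>, \<open>D\<close> exceeds the barrier minus the energy, and the energy
    is at most (1 + a)/2 r^p + Ca.\<close>
  have "X \<le> - (\<Sum>k\<in>Basis. g k k)"
  proof -
    have "- (\<Sum>k\<in>Basis. g k k) \<ge> - (\<Sum>k\<in>Basis. Hu x t k \<bullet> k) - eps"
      using E3 unfolding g_def by linarith
    moreover have "ut x t - (\<Sum>k\<in>Basis. Hu x t k \<bullet> k) = r powr p"
      using classical_solD(4)[OF sol x0(1) dom(2) x0(2)] by (simp add: r_def q_def)
    moreover have "B\<^sup>2 * (z\<^sup>2 + \<tau>) < a * (1 + s\<^sup>2) powr (p/2) + D h x t"
      using pos by (simp add: \<psi> w_def s2)
    moreover have "X = B\<^sup>2 * (z\<^sup>2 + \<tau>) - B\<^sup>2 * (z\<^sup>2 + \<tau>) / 2 + r powr p - (1 + a) / 2 * r powr p"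
      by (simp add: X_def field_simps)
    ultimately show ?thesis using absorb E2 X2(2) eps(2) by linarith
  qed
  then have "X\<^sup>2 \<le> (\<Sum>k\<in>Basis. g k k)\<^sup>2" using X2(1) by (subst (2) power2_minus[symmetric], intro power_mono) auto
  then have "X\<^sup>2 / n \<le> (\<Sum>k\<in>Basis. g k k)\<^sup>2 / n" using n by (intro divide_right_mono) auto
  also have "\<dots> \<le> (\<Sum>k\<in>Basis. \<Sum>i\<in>Basis. (g i k)\<^sup>2)"
    unfolding n_def by (rule trace_squared_le)
  finally have tr: "X\<^sup>2 / n \<le> (\<Sum>k\<in>Basis. \<Sum>i\<in>Basis. (g i k)\<^sup>2)" .
  \<comment> \<open>The space remainders have no useful sign against \<open>c h i x t\<close>; their
    total is made at most 1/n and reappears as the -1 in X^2 - 1.\<close>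
  have err: "(\<Sum>i\<in>Basis. c h i x t * \<rho> i) \<le> 1 / n"
  proof -
    have "(\<Sum>i\<in>Basis. c h i x t * \<rho> i) \<le> (\<Sum>i\<in>(Basis::'a set). (M + 1) * eps)"
    proof (intro sum_mono)
      fix i :: 'a assume i: "i \<in> Basis"
      have "\<bar>c h i x t\<bar> \<le> M + 1" using E1[OF i] Basis_le_norm[OF i, of "gu x t"] M eps(2) by linarith
      then have "\<bar>c h i x t\<bar> * \<bar>\<rho> i\<bar> \<le> (M + 1) * eps"
        using E4[OF i] by (intro mult_mono) (auto simp: \<rho>_def)
      then show "c h i x t * \<rho> i \<le> (M + 1) * eps" by (metis abs_ge_self abs_mult order_trans)
    qed
    also have "\<dots> = n * ((M + 1) * eps)" by (simp add: n_def)
    finally show ?thesis using eps(4) by linarith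
  qed
  define \<psi>1 where "\<psi>1 k r = B\<^sup>2 * (4 * ((x + r *\<^sub>R k) \<bullet> k) / (9/16 - (x + r *\<^sub>R k) \<bullet> (x + r *\<^sub>R k)) ^ 3)" for k r
  define \<psi>2 where "\<psi>2 k = B\<^sup>2 * (4 / d ^ 3 + 24 * (x \<bullet> k)\<^sup>2 / d ^ 4)" for k
  have ns: "norm ((x + r *\<^sub>R k) - x) < e" if "k \<in> Basis" "\<bar>r\<bar> < e" for r k using that by simp
  have "- B\<^sup>2 / (t - t1)\<^sup>2 - (\<Sum>k\<in>Basis. \<psi>2 k) - (\<Sum>k\<in>Basis. (norm_powr_grad p q \<bullet> k) * \<psi>1 k 0)
      \<le> a * (p * (1 + s\<^sup>2) powr (p/2 - 1)) *
        ((\<Sum>i\<in>Basis. c h i x t * \<rho> i) - (\<Sum>k\<in>Basis. \<Sum>i\<in>Basis. (g i k)\<^sup>2))"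
    unfolding q_def s2 \<rho>_def g_def c_def
  proof (rule difference_energy_max[where \<psi> = "\<psi> B t1", OF sol p _ h e dom])
    show "((\<lambda>r. \<psi> B t1 (x + r *\<^sub>R k) t) has_real_derivative \<psi>1 k s) (at s)" if k: "k \<in> Basis" "\<bar>s\<bar> < e" for k s
      unfolding \<psi>_def \<psi>1_def using int(2)[OF ns[OF k]]
      by (intro barrier_derivatives(1) k) auto
    show "(\<psi>1 k has_real_derivative \<psi>2 k) (at 0)" if "k \<in> Basis" for k
      unfolding \<psi>2_def \<psi>1_def d_def using d that by (intro barrier_derivatives(2)) (auto simp: d_def)
    show "(\<psi> B t1 x has_real_derivative - B\<^sup>2 / (t - t1)\<^sup>2) (at t)"
      unfolding \<psi>_def using int by (intro barrier_derivatives(3)) auto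
  qed (use a maxt maxx[OF ns] in \<open>auto simp: w_def c_def D_def\<close>)
  also have "\<dots> \<le> a * (p * (1 + s\<^sup>2) powr (p/2 - 1)) * (1 / n - X\<^sup>2 / n)"
    using a p tr err by (intro mult_left_mono diff_mono) auto
  also have "\<dots> = - (a * p * (1 + s\<^sup>2) powr (p/2 - 1) / n * (X\<^sup>2 - 1))"
    using n by (simp add: field_simps)
  also have "\<dots> \<le> - (k1 * m * (X\<^sup>2 - 1))"
  proof -
    have "a * p / n * ((1/2) powr (p/2 - 1) * m) \<le> a * p / n * (1 + s\<^sup>2) powr (p/2 - 1)"
      using mc a p n by (intro mult_left_mono) auto
    then have "k1 * m * (X\<^sup>2 - 1) \<le> a * p * (1 + s\<^sup>2) powr (p/2 - 1) / n * (X\<^sup>2 - 1)"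
      using X2(1) by (intro mult_right_mono) (auto simp: k1_def)
    then show ?thesis by simp
  qed
  finally have upper: "- B\<^sup>2 / (t - t1)\<^sup>2 - (\<Sum>k\<in>Basis. \<psi>2 k) - (\<Sum>k\<in>Basis. (norm_powr_grad p q \<bullet> k) * \<psi>1 k 0)
    \<le> - (k1 * m * (X\<^sup>2 - 1))" .
  have "(\<Sum>k\<in>Basis. \<psi>2 k) = B\<^sup>2 * (n * (4 * z^3) + 24 * (x \<bullet> x) * z^4)"
    unfolding euclidean_inner[of x x]
    by (simp add: \<psi>2_def z_def n_def power_one_over sum.distrib sum_distrib_left sum_distrib_right distrib_left power2_eq_square mult_ac)
  \<comment> \<open>Since d <= 9/16, z is at least 1 and z^3 <= z^4; moreover |x|^2 < 1.\<close>
  also have "\<dots> \<le> B\<^sup>2 * (n * (4 * z^4) + 24 * 1 * z^4)"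
    using z n d by (intro mult_left_mono add_mono mult_right_mono power_increasing) (auto simp: d_def)
  finally have L2: "(\<Sum>k\<in>Basis. \<psi>2 k) \<le> B\<^sup>2 * (4 * n + 24) * z^4" by (simp add: algebra_simps)
  have "(\<Sum>k\<in>Basis. (norm_powr_grad p q \<bullet> k) * \<psi>1 k 0) = 4 * B\<^sup>2 * z^3 * (norm_powr_grad p q \<bullet> x)"
    unfolding euclidean_inner[of "norm_powr_grad p q" x]
    by (simp add: \<psi>1_def d_def[symmetric] z_def power_one_over sum_distrib_left sum_divide_distrib mult_ac)
  also have "\<dots> \<le> 4 * B\<^sup>2 * z^3 * (p * r powr (p - 1) * 1)"
  proof (intro mult_left_mono)
    have "norm_powr_grad p q \<bullet> x \<le> norm (norm_powr_grad p q) * norm x" by (rule norm_cauchy_schwarz)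
    also have "\<dots> \<le> norm (norm_powr_grad p q) * 1" using x0 by (intro mult_left_mono) auto
    finally show "norm_powr_grad p q \<bullet> x \<le> p * r powr (p - 1) * 1"
      by (simp add: norm_norm_powr_grad[OF p] r_def)
  qed (use z in auto)
  finally have L1: "(\<Sum>k\<in>Basis. (norm_powr_grad p q \<bullet> k) * \<psi>1 k 0) \<le> 4 * p * B\<^sup>2 * r powr (p - 1) * z^3"
    by (simp add: mult_ac)
  have "B\<^sup>2 * \<tau>\<^sup>2 + B\<^sup>2 * (4 * n + 24) * z^4 + 4 * p * B\<^sup>2 * r powr (p - 1) * z^3 < k1 * m * (X\<^sup>2 - 1)"
    unfolding X_def
    by (rule barrier_dominates) (use k1 a n p B r0 z \<tau> m1 m2 in \<open>auto simp: k1_def\<close>)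
  moreover have "- B\<^sup>2 / (t - t1)\<^sup>2 = - (B\<^sup>2 * \<tau>\<^sup>2)" by (simp add: \<tau>_def power_one_over)
  ultimately show False using upper L1 L2 by linarith
qed

text \<open>If the bound failed at (x0, t0), the discretised function would exceed the barrier
  there. Its excess over the barrier would then be maximal at a point away from the lateral and
  initial blow-up sets, which \<open>barrier_no_interior_max\<close> excludes.\<close>

lemma unit_barrier_estimate:
  fixes u :: "'a::euclidean_space \<Rightarrow> real \<Rightarrow> real"
  defines "n \<equiv> real DIM('a)"
  assumes p: "p > 2" and a: "0 < a" "a < 1"
    and Ca: "\<And>r. r \<ge> 0 \<Longrightarrow> a * (1 + (r + 1)\<^sup>2) powr (p/2) \<le> (1 + a) / 2 * r powr p + Ca" "Ca \<ge> 0"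
    and B: "B \<ge> 1" "2 * Ca + 2 \<le> B\<^sup>2" "4 * p \<le> B * (a * p * (1/2) powr (p/2 - 1) / n * ((1 - a) / 2)\<^sup>2)"
      "B\<^sup>2 * (4 * n + 25) + 4 * p * B^3 + 4 * p / B + a * p * (1/2) powr (p/2 - 1) / n
        < a * p * (1/2) powr (p/2 - 1) / n * B^4 / 4"
    and sol: "classical_sol p 1 T u gu Hu ut" and x0: "norm x0 < 1/2" and t0: "0 < t0" "t0 < T"
  shows "a * norm (gu x0 t0) powr p - ut x0 t0 \<le> (11 * B\<^sup>2 + 1) * (1 + 1 / t0)"
proof (rule ccontr)
  assume contra: "\<not> ?thesis"
  \<comment> \<open>The barrier starts at half the time, so that 1 / (t0 - t1) = 2 / t0.\<close>
  define t1 where "t1 = t0 / 2"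
  define Z where "Z = cball (0::'a) (3/4) \<times> {t1..t0}"
  have t1: "0 < t1" "t1 < t0" using t0 by (auto simp: t1_def)
  have ZQ: "Z \<subseteq> Qcyl 1 T" using t0 t1 by (auto simp: Z_def Qcyl_def)
  have Z: "compact Z" unfolding Z_def by (intro compact_Times) auto
  have "continuous_on Z (\<lambda>z. gu (fst z) (snd z))"
    using sol ZQ unfolding classical_sol_def by (auto simp: case_prod_unfold intro: continuous_on_subset)
  from compact_imp_bounded[OF compact_continuous_image[OF this Z]]
  obtain M where M0: "M > 0" "\<And>z. z \<in> Z \<Longrightarrow> norm (gu (fst z) (snd z)) \<le> M"
    by (auto simp: bounded_pos)
  have M: "norm (gu x t) \<le> M" if "(x, t) \<in> Z" for x t using M0(2)[OF that] by simp
  have n: "n \<ge> 1" unfolding n_def by (simp add: Suc_leI)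
  \<comment> \<open>One choice serves three demands: n eps <= 1/4, 2 n eps M <= 1 and n (M + 1) eps
    <= 1/n. It depends on the solution through \<open>M\<close>, but disappears from the final
    bound.\<close>
  define eps where "eps = 1 / (n\<^sup>2 * (2 * M + 4))"
  have eps0: "eps > 0" using n M0 by (simp add: eps_def)
  have neps: "n * (n * eps) * (2 * M + 4) = 1" using n M0 by (simp add: eps_def power2_eq_square)
  have eps_n: "n * eps * (2 * M + 4) \<le> 1"
  proof -
    have "1 * (n * eps * (2 * M + 4)) \<le> n * (n * eps * (2 * M + 4))"
      using n eps0 M0 by (intro mult_right_mono) auto
    then show ?thesis using neps by (simp add: mult_ac)
  qed
  have nM: "n * eps * M \<ge> 0" "n * eps \<ge> eps" using n eps0 M0 by auto
  have e14: "n * eps \<le> 1/4" "2 * (n * eps) * M \<le> 1" proof -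
    have "n * eps * (2 * M + 4) = 2 * (n * eps) * M + 4 * (n * eps)" by (simp add: algebra_simps)
    then show "n * eps \<le> 1/4" "2 * (n * eps) * M \<le> 1" using eps_n nM eps0 by linarith+
  qed
  have eps: "eps \<ge> 0" "eps \<le> 1/4" "n * eps \<le> 1/4" "n * ((M + 1) * eps) \<le> 1 / n"
  proof -
    have "n * (n * ((M + 1) * eps)) * 2 \<le> 1"
    proof -
      have "n * (n * ((M + 1) * eps)) * 2 = n * (n * eps) * (2 * M + 4) - 2 * (n * (n * eps))"
        by (simp add: algebra_simps)
      moreover have "0 \<le> n * (n * eps)" using n eps0 by simp
      ultimately show ?thesis using neps by linarith
    qed
    moreover have "0 \<le> n * (n * ((M + 1) * eps))" using n eps0 M0 by simp
    ultimately show "n * ((M + 1) * eps) \<le> 1 / n" using n by (simp add: field_simps)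
  qed ((use eps0 e14 nM in linarith)+)
  have "eventually (\<lambda>h. h \<in> {0<..<min (1/8) (T - t0)}) (at_right 0)"
    by (rule eventually_at_right_real) (use t0 in auto)
  with classical_sol_difference_quotients[OF sol p t1(1) less_imp_le[OF t1(2)] t0(2) eps0]
  have "eventually (\<lambda>h. h \<in> {0<..<min (1/8) (T - t0)} \<and> (\<forall>x\<in>cball 0 (3/4). \<forall>t\<in>{t1..t0}.
    (\<forall>i\<in>Basis. \<bar>(u (x + h *\<^sub>R i) t - u x t) / h - gu x t \<bullet> i\<bar> \<le> eps) \<and>
    \<bar>(u x t - u x (t + h)) / h + ut x t\<bar> \<le> eps \<and>
    \<bar>(\<Sum>k\<in>Basis. ((gu (x + h *\<^sub>R k) t - gu x t) \<bullet> k) / h) - (\<Sum>k\<in>Basis. Hu x t k \<bullet> k)\<bar> \<le> eps \<and>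
    (\<forall>i\<in>Basis. \<bar>(norm (gu (x + h *\<^sub>R i) t) powr p - norm (gu x t) powr p
          - norm_powr_grad p (gu x t) \<bullet> (gu (x + h *\<^sub>R i) t - gu x t)) / h\<bar> \<le> eps))) (at_right 0)"
    by eventually_elim blast
  from eventually_happens'[OF trivial_limit_at_right_real this]
  obtain h where h: "0 < h" "h < 1/8" "h < T - t0"
    and E: "\<And>x t i. (x, t) \<in> Z \<Longrightarrow> i \<in> Basis \<Longrightarrow> \<bar>(u (x + h *\<^sub>R i) t - u x t) / h - gu x t \<bullet> i\<bar> \<le> eps"
      "\<And>x t. (x, t) \<in> Z \<Longrightarrow> \<bar>(u x t - u x (t + h)) / h + ut x t\<bar> \<le> eps"
      "\<And>x t. (x, t) \<in> Z \<Longrightarrow> \<bar>(\<Sum>k\<in>Basis. ((gu (x + h *\<^sub>R k) t - gu x t) \<bullet> k) / h) - (\<Sum>k\<in>Basis. Hu x t k \<bullet> k)\<bar> \<le> eps"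
      "\<And>x t i. (x, t) \<in> Z \<Longrightarrow> i \<in> Basis \<Longrightarrow> \<bar>(norm (gu (x + h *\<^sub>R i) t) powr p - norm (gu x t) powr p
          - norm_powr_grad p (gu x t) \<bullet> (gu (x + h *\<^sub>R i) t - gu x t)) / h\<bar> \<le> eps"
    unfolding Z_def by auto
  define w where "w y s = a * (1 + (\<Sum>i\<in>Basis. ((u (y + h *\<^sub>R i) s - u y s) / h)\<^sup>2)) powr (p/2)
    + (u y s - u y (s + h)) / h" for y s
  define \<psi> where "\<psi> y s = B\<^sup>2 * (1 / (9/16 - y \<bullet> y)\<^sup>2 + 1 / (s - t1))" for y :: 'a and s
  have norm_sq: "norm y < r \<longleftrightarrow> y \<bullet> y < r\<^sup>2" "norm y \<le> r \<longleftrightarrow> y \<bullet> y \<le> r\<^sup>2" if "r > 0" for y :: 'a and r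
    using that by (auto simp: norm_lt_square norm_le_square)
  have x0': "x0 \<bullet> x0 < 1/4" using norm_sq(1)[of "1/2" x0] x0 by (simp add: power2_eq_square)
  have z0: "(x0, t0) \<in> Z" using x0 t1 by (simp add: Z_def)
  have pos0: "\<psi> x0 t0 < w x0 t0"
  proof -
    define s where "s = norm (\<Sum>i\<in>Basis. ((u (x0 + h *\<^sub>R i) t0 - u x0 t0) / h) *\<^sub>R i)"
    define r where "r = norm (gu x0 t0)"
    have "\<bar>s - r\<bar> \<le> n * eps"
      unfolding s_def r_def n_def by (rule norm_coordinates_close) (rule E(1)[OF z0])
    \<comment> \<open>The 1 in the energy absorbs the discretisation: if r > s, then r^2 - s^2 is at
      most n eps times 2 M, hence at most 1.\<close>
    have r2: "r\<^sup>2 \<le> 1 + s\<^sup>2"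
    proof (cases "r \<le> s")
      case True
      then have "r\<^sup>2 \<le> s\<^sup>2" by (intro power_mono) (auto simp: r_def)
      then show ?thesis by simp
    next
      case False
      then have "(r - s) * (r + s) \<le> (n * eps) * (2 * M)"
        using \<open>\<bar>s - r\<bar> \<le> n * eps\<close> M[OF z0] n eps0
        by (intro mult_mono) (auto simp: r_def s_def)
      then show ?thesis using e14(2) by (simp add: algebra_simps power2_eq_square)
    qed
    have "r powr p = (r\<^sup>2) powr (p/2)"
    proof (cases "r = 0")
      case False
      then have "r\<^sup>2 = r powr 2" by (simp add: r_def)
      moreover have "(r powr 2) powr (p/2) = r powr p" unfolding powr_powr by simp
      ultimately show ?thesis by (simp only:)
    qed simp
    also have "\<dots> \<le> (1 + s\<^sup>2) powr (p/2)" using r2 p by (intro powr_mono2) auto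
    finally have "a * r powr p \<le> a * (1 + s\<^sup>2) powr (p/2)" using a by simp
    moreover have "w x0 t0 = a * (1 + s\<^sup>2) powr (p/2) + (u x0 t0 - u x0 (t0 + h)) / h"
      unfolding w_def s_def norm_sum_Basis_squared ..
    moreover have "\<psi> x0 t0 \<le> 11 * B\<^sup>2 + 2 * B\<^sup>2 / t0"
    proof -
      \<comment> \<open>Here 9/16 - 1/4 = 5/16, and (16/5)^2 = 10.24 is rounded up to the 11 in the
        constant; its summand 1 covers the error of the time quotient.\<close>
      have "(5/16)\<^sup>2 \<le> (9/16 - x0 \<bullet> x0)\<^sup>2" using x0' by (intro power_mono) auto
      then have "1 / (9/16 - x0 \<bullet> x0)\<^sup>2 \<le> 1 / (5/16)\<^sup>2" by (intro divide_left_mono mult_pos_pos) (use x0' in auto)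
      then have "1 / (9/16 - x0 \<bullet> x0)\<^sup>2 \<le> 11" by (simp add: power2_eq_square)
      then have "\<psi> x0 t0 \<le> B\<^sup>2 * (11 + 1 / (t0 - t1))"
        unfolding \<psi>_def by (intro mult_left_mono add_right_mono) auto
      then show ?thesis by (simp add: t1_def algebra_simps)
    qed
    moreover have "11 * B\<^sup>2 + 1 + 2 * B\<^sup>2 / t0 \<le> (11 * B\<^sup>2 + 1) * (1 + 1 / t0)"
    proof -
      have "2 * B\<^sup>2 / t0 \<le> (11 * B\<^sup>2 + 1) / t0" using t0 by (intro divide_right_mono) auto
      then show ?thesis by (simp add: distrib_left)
    qed
    ultimately show ?thesis using contra E(2)[OF z0] eps(2) unfolding r_def by linarith
  qed
  have cu: "continuous_on Z (\<lambda>z. u (X z) (\<theta> z))"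
    if "continuous_on Z X" "continuous_on Z \<theta>" "\<And>z. z \<in> Z \<Longrightarrow> norm (X z) < 1 \<and> 0 < \<theta> z \<and> \<theta> z < T" for X \<theta>
  proof -
    have "continuous_on (Qcyl 1 T) (\<lambda>z. u (fst z) (snd z))"
      using sol unfolding classical_sol_def case_prod_unfold by blast
    from continuous_on_compose2[OF this, of Z "\<lambda>z. (X z, \<theta> z)"] show ?thesis
      using that by (fastforce simp: Qcyl_def intro: continuous_intros)
  qed
  have cw: "continuous_on Z (\<lambda>z. w (fst z) (snd z))"
  proof -
    have "continuous_on Z (\<lambda>z. u (fst z + h *\<^sub>R i) (snd z))" if "i \<in> Basis" for i
    proof (rule cu)
      fix z assume "z \<in> Z"
      then show "norm (fst z + h *\<^sub>R i) < 1 \<and> 0 < snd z \<and> snd z < T"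
        using norm_triangle_ineq[of "fst z" "h *\<^sub>R i"] that h t0 t1 by (auto simp: Z_def)
    qed (intro continuous_intros)+
    moreover have "continuous_on Z (\<lambda>z. u (fst z) (snd z))"
      by (rule cu) (use t0 t1 in \<open>auto simp: Z_def intro!: continuous_intros\<close>)
    moreover have "continuous_on Z (\<lambda>z. u (fst z) (snd z + h))"
      by (rule cu) (use t0 t1 h in \<open>auto simp: Z_def intro!: continuous_intros\<close>)
    moreover have "1 + (\<Sum>i\<in>Basis. ((u (y + h *\<^sub>R i) s - u y s) / h)\<^sup>2) \<noteq> 0" for y s
      by (smt (verit) sum_nonneg zero_le_power2)
    ultimately show ?thesis
      unfolding w_def using h by (intro continuous_intros) auto
  qed
  from compact_imp_bounded[OF compact_continuous_image[OF cw Z]]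
  obtain W where W0: "W > 0" "\<And>z. z \<in> Z \<Longrightarrow> norm (w (fst z) (snd z)) \<le> W"
    by (auto simp: bounded_pos)
  have W: "w x t \<le> W" if "(x, t) \<in> Z" for x t using W0(2)[OF that] by simp
  \<comment> \<open>The last bound makes B^2 / \<delta> at least W + 1, so the barrier exceeds
    \<open>w\<close> wherever d or t - t1 equals \<delta>. The bound 5/16 keeps x0, and the bound t1
    = t0 - t1 keeps t0, inside the trimmed region.\<close>
  define \<delta> where "\<delta> = min (min (5/16) t1) (min 1 (B\<^sup>2 / (W + 1)))"
  have "\<delta> > 0" using t1 W0(1) B(1) by (simp add: \<delta>_def)
  moreover have "\<delta> \<le> 5/16" "\<delta> \<le> t1" "\<delta> \<le> 1" "\<delta> \<le> B\<^sup>2 / (W + 1)"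
    unfolding \<delta>_def by (simp_all only: min_le_iff_disj order_refl simp_thms)
  ultimately have \<delta>: "\<delta> > 0" "\<delta> \<le> 5/16" "\<delta> \<le> t1" "\<delta> \<le> 1" "\<delta> \<le> B\<^sup>2 / (W + 1)" .
  \<comment> \<open>Removing the blow-up sets leaves a compact region on which the barrier is
    continuous. The slice t = t0 belongs to it, and a maximum there is allowed.\<close>
  define S where "S = Z \<inter> {z. fst z \<bullet> fst z \<le> 9/16 - \<delta> \<and> t1 + \<delta> \<le> snd z}"
  have "closed {z :: 'a \<times> real. fst z \<bullet> fst z \<le> 9/16 - \<delta> \<and> t1 + \<delta> \<le> snd z}"
    by (intro closed_Collect_conj closed_Collect_le continuous_intros)
  then have S: "compact S" unfolding S_def using Z by (rule compact_Int_closed[rotated])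
  have z0S: "(x0, t0) \<in> S" using z0 x0' \<delta> by (auto simp: S_def t1_def)
  have "continuous_on S (\<lambda>z. w (fst z) (snd z) - \<psi> (fst z) (snd z))"
    unfolding \<psi>_def using \<delta>
    by (intro continuous_intros continuous_on_subset[OF cw]) (auto simp: S_def)
  from continuous_attains_sup[OF S _ this] z0S
  obtain z where z: "z \<in> S" "\<And>y. y \<in> S \<Longrightarrow> w (fst y) (snd y) - \<psi> (fst y) (snd y) \<le> w (fst z) (snd z) - \<psi> (fst z) (snd z)"
    by blast
  obtain x t where zxt: "z = (x, t)" by (cases z)
  have xtS: "(x, t) \<in> S" and max: "\<And>y s. (y, s) \<in> S \<Longrightarrow> w y s - \<psi> y s \<le> w x t - \<psi> x t"
    using z zxt by auto
  have xtZ: "(x, t) \<in> Z" using xtS by (simp add: S_def)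
  have pos: "\<psi> x t < w x t" using max[OF z0S] pos0 by simp
  define d where "d = 9/16 - x \<bullet> x"
  have d0: "\<delta> \<le> d" "\<delta> \<le> t - t1" using xtS by (auto simp: S_def d_def)
  have big: "W + 1 \<le> B\<^sup>2 / \<delta>" using \<delta> W0 by (simp add: field_simps)
  have \<psi>W: "B\<^sup>2 * (1 / d\<^sup>2 + 1 / (t - t1)) < W + 1" using pos W[OF xtZ] by (simp add: \<psi>_def d_def)
  have d: "\<delta> < d"
  proof (rule ccontr)
    assume "\<not> \<delta> < d"
    then have "d = \<delta>" using d0 by simp
    have "\<delta>\<^sup>2 \<le> \<delta>" using \<delta> by (simp add: power2_eq_square mult_left_le)
    then have "1 / \<delta> \<le> 1 / d\<^sup>2" unfolding \<open>d = \<delta>\<close> using \<delta> by (intro divide_left_mono) auto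
    moreover have "0 \<le> 1 / (t - t1)" using d0 \<delta> by simp
    ultimately have "1 / \<delta> \<le> 1 / d\<^sup>2 + 1 / (t - t1)" by linarith
    then have "B\<^sup>2 * (1 / \<delta>) \<le> B\<^sup>2 * (1 / d\<^sup>2 + 1 / (t - t1))" by (intro mult_left_mono) auto
    with big \<psi>W show False by simp
  qed
  have \<tau>: "\<delta> < t - t1"
  proof (rule ccontr)
    assume "\<not> \<delta> < t - t1"
    then have "t - t1 = \<delta>" using d0 by simp
    then have "B\<^sup>2 * (1 / \<delta>) \<le> B\<^sup>2 * (1 / d\<^sup>2 + 1 / (t - t1))" by (intro mult_left_mono) auto
    with big \<psi>W show False by simp
  qed
  have "open {y::'a. y \<bullet> y < 9/16 - \<delta>}" by (intro open_Collect_less continuous_intros)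
  moreover have "x \<in> {y. y \<bullet> y < 9/16 - \<delta>}" using d by (simp add: d_def)
  ultimately obtain e0 where e0: "e0 > 0" "\<And>y. dist y x < e0 \<Longrightarrow> y \<bullet> y < 9/16 - \<delta>"
    unfolding open_dist by blast
  \<comment> \<open>All comparison points must stay in \<open>S\<close>, and 3/4 + 1/16 + 1/8 < 1
    keeps their shifts in the unit ball.\<close>
  define e where "e = min e0 (min (1/16) (t - t1 - \<delta>))"
  have e: "e > 0" using e0 \<tau> by (simp add: e_def)
  have near: "y \<bullet> y < 9/16 - \<delta>" if "norm (y - x) < e" for y
    using e0(2)[of y] that by (simp add: e_def dist_norm)
  have nZ: "norm y \<le> 3/4" if "y \<bullet> y \<le> 9/16 - \<delta>" for y :: 'a
    using norm_sq(2)[of "3/4" y] that \<delta> by (simp add: power2_eq_square)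
  have xt: "norm x \<le> 3/4" "t1 < t" "t \<le> t0" using xtZ \<tau> \<delta> by (auto simp: Z_def)
  show False
  proof (rule barrier_no_interior_max[OF sol p a h(1) e, where x = x and t = t and ?t1.0 = t1 and B = B and Ca = Ca and M = M and eps = eps])
    show "norm x + e + h < 1" "0 < t" "t + h < T" "t1 < t" using xt h t1 by (auto simp: e_def)
    show "y \<bullet> y < 9/16" if "norm (y - x) < e" for y using near[OF that] \<delta> by simp
    have "w x s - \<psi> x s \<le> w x t - \<psi> x t" if "t - e < s" "s \<le> t" for s
    proof (rule max)
      have "e \<le> t - t1 - \<delta>" by (simp add: e_def)
      then have "t1 + \<delta> \<le> s" using that by linarith
      then show "(x, s) \<in> S" using that xtS \<delta>(1) by (auto simp: S_def Z_def)
    qed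
    then show "t - e < s \<Longrightarrow> s \<le> t \<Longrightarrow>
        a * (1 + (\<Sum>i\<in>Basis. ((u (x + h *\<^sub>R i) s - u x s) / h)\<^sup>2)) powr (p / 2) + (u x s - u x (s + h)) / h
          - B\<^sup>2 * (1 / (9 / 16 - x \<bullet> x)\<^sup>2 + 1 / (s - t1))
        \<le> a * (1 + (\<Sum>i\<in>Basis. ((u (x + h *\<^sub>R i) t - u x t) / h)\<^sup>2)) powr (p / 2) + (u x t - u x (t + h)) / h
          - B\<^sup>2 * (1 / (9 / 16 - x \<bullet> x)\<^sup>2 + 1 / (t - t1))" for s
      by (simp only: w_def \<psi>_def)
    have "w y t - \<psi> y t \<le> w x t - \<psi> x t" if "norm (y - x) < e" for y
      by (rule max) (use near[OF that] nZ[of y] xtS in \<open>auto simp: S_def Z_def\<close>)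
    then show "norm (y - x) < e \<Longrightarrow>
        a * (1 + (\<Sum>i\<in>Basis. ((u (y + h *\<^sub>R i) t - u y t) / h)\<^sup>2)) powr (p / 2) + (u y t - u y (t + h)) / h
          - B\<^sup>2 * (1 / (9 / 16 - y \<bullet> y)\<^sup>2 + 1 / (t - t1))
        \<le> a * (1 + (\<Sum>i\<in>Basis. ((u (x + h *\<^sub>R i) t - u x t) / h)\<^sup>2)) powr (p / 2) + (u x t - u x (t + h)) / h
          - B\<^sup>2 * (1 / (9 / 16 - x \<bullet> x)\<^sup>2 + 1 / (t - t1))" for y
      by (simp only: w_def \<psi>_def)
    show "B\<^sup>2 * (1 / (9 / 16 - x \<bullet> x)\<^sup>2 + 1 / (t - t1))
      < a * (1 + (\<Sum>i\<in>Basis. ((u (x + h *\<^sub>R i) t - u x t) / h)\<^sup>2)) powr (p / 2) + (u x t - u x (t + h)) / h"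
      using pos by (simp only: w_def \<psi>_def)
  qed (use Ca B M[OF xtZ] eps E[OF xtZ] in \<open>simp_all add: n_def\<close>)
qed

text \<open>\<open>Ca\<close> and \<open>B\<close> are obtained before any solution is introduced,
  which is what makes the constant uniform in u and T.\<close>

lemma unit_estimate:
  assumes p: "p > 2" and a: "0 < a" "a < 1"
  shows "\<exists>C>0. \<forall>T (u :: 'a::euclidean_space \<Rightarrow> real \<Rightarrow> real) gu Hu ut x t.
    classical_sol p 1 T u gu Hu ut \<and> norm x < 1/2 \<and> 0 < t \<and> t < T \<longrightarrow>
    a * norm (gu x t) powr p - ut x t \<le> C * (1 + 1 / t)"
proof -
  obtain Ca where Ca: "Ca \<ge> 0" "\<And>r. r \<ge> 0 \<Longrightarrow> a * (1 + (r + 1)\<^sup>2) powr (p/2) \<le> (1 + a) / 2 * r powr p + Ca"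
    using energy_absorb[OF a p] by blast
  have "a * p * (1/2) powr (p/2 - 1) / real DIM('a) > 0" "(1 - a) / 2 > 0" using a p by auto
  from ex_barrier_constant[OF this, of p "real DIM('a)" "2 * Ca + 2"]
  obtain B where B: "B \<ge> 1" "2 * Ca + 2 \<le> B\<^sup>2"
      "4 * p \<le> B * (a * p * (1/2) powr (p/2 - 1) / real DIM('a) * ((1 - a) / 2)\<^sup>2)"
      "B\<^sup>2 * (4 * real DIM('a) + 25) + 4 * p * B^3 + 4 * p / B + a * p * (1/2) powr (p/2 - 1) / real DIM('a)
        < a * p * (1/2) powr (p/2 - 1) / real DIM('a) * B^4 / 4" by blast
  show ?thesis
  proof (intro exI[of _ "11 * B\<^sup>2 + 1"] conjI allI impI)
    show "0 < 11 * B\<^sup>2 + 1" by (simp add: add_nonneg_pos)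
  qed (use unit_barrier_estimate[OF p a Ca(2,1) B] in blast)
qed

section \<open>Joint differentiability and parabolic scaling\<close>

text \<open>A spatial derivative at the point together with a jointly continuous time derivative
  gives the total derivative. It is what the chain rule along a segment moving in both space and
  time requires.\<close>

lemma classical_sol_joint_derivative:
  assumes sol: "classical_sol p R T u gu Hu ut" and x: "x \<in> ball 0 R" and t: "0 < t" "t < T"
  shows "((\<lambda>(x, t). u x t) has_derivative (\<lambda>(h, s). gu x t \<bullet> h + s * ut x t)) (at (x, t))"
proof -
  have Q: "open (ball 0 R \<times> {0<..<T})" "(x, t) \<in> ball 0 R \<times> {0<..<T}" using x t by (auto intro: open_Times)
  have "((\<lambda>(x, t). u x t) has_derivative (\<lambda>(h, s). (\<bullet>) (gu x t) h + blinfun_scaleR_left (ut x t) s))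
      (at (x, t) within ball 0 R \<times> {0<..<T})"
  proof (rule has_derivative_partialsI[where f = u and fx = "(\<bullet>) (gu x t)" and fy = "\<lambda>x t. blinfun_scaleR_left (ut x t)"])
    show "((\<lambda>x. u x t) has_derivative (\<bullet>) (gu x t)) (at x within ball 0 R)"
      using classical_solD(1)[OF sol x t] by (rule has_derivative_at_withinI)
    show "((\<lambda>t. u x t) has_derivative blinfun_apply (blinfun_scaleR_left (ut x t))) (at t within {0<..<T})"
      if "x \<in> ball 0 R" "t \<in> {0<..<T}" for x t
      by (rule has_derivative_at_withinI)
        (use classical_solD(3)[OF sol, of x t] that in \<open>simp add: has_field_derivative_def mult_commute_abs\<close>)
    have "continuous_on (ball 0 R \<times> {0<..<T}) (\<lambda>(x, t). ut x t)"
      using sol unfolding classical_sol_def Qcyl_def by blast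
    then have "continuous_on (ball 0 R \<times> {0<..<T}) (\<lambda>z. blinfun_scaleR_left ((\<lambda>(x, t). ut x t) z))"
      by (intro bounded_linear.continuous_on[OF bounded_linear_blinfun_scaleR_left])
    then show "continuous (at (x, t) within ball 0 R \<times> {0<..<T}) (\<lambda>(x, t). blinfun_scaleR_left (ut x t))"
      using Q(2) by (simp add: continuous_on_eq_continuous_within case_prod_unfold)
  qed (use t in auto)
  then show ?thesis using at_within_open[OF Q(2,1)] by simp
qed

text \<open>With the prefactor R^(\<beta>-1) the gradient scales by R^\<beta>, and u_t and the
  Laplacian by R^(\<beta>+1). The equation is preserved because \<beta> p = \<beta> + 1.\<close>

lemma classical_sol_rescale:
  fixes u :: "'a::euclidean_space \<Rightarrow> real \<Rightarrow> real" and p R :: real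
  defines "\<beta> \<equiv> 1 / (p - 1)"
  assumes sol: "classical_sol p R T u gu Hu ut" and p: "p > 2" and R: "R > 0"
  shows "classical_sol p 1 (T / R\<^sup>2) (\<lambda>y s. R powr (\<beta> - 1) * u (R *\<^sub>R y) (R\<^sup>2 * s))
    (\<lambda>y s. R powr \<beta> *\<^sub>R gu (R *\<^sub>R y) (R\<^sup>2 * s)) (\<lambda>y s h. R powr (\<beta> + 1) *\<^sub>R Hu (R *\<^sub>R y) (R\<^sup>2 * s) h)
    (\<lambda>y s. R powr (\<beta> + 1) * ut (R *\<^sub>R y) (R\<^sup>2 * s))"
proof -
  have R1: "R powr \<beta> = R powr (\<beta> - 1) * R" "R powr (\<beta> + 1) = R powr \<beta> * R" "R powr (\<beta> + 1) = R powr (\<beta> - 1) * R\<^sup>2"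
    using R by (simp_all add: powr_add powr_diff power2_eq_square)
  have \<beta>p: "\<beta> * p = \<beta> + 1" using p by (simp add: \<beta>_def field_simps)
  have inQ: "(R *\<^sub>R y, R\<^sup>2 * s) \<in> Qcyl R T" if "(y, s) \<in> Qcyl 1 (T / R\<^sup>2)" for y :: 'a and s
    using that R by (auto simp: Qcyl_def field_simps)
  have cont: "continuous_on (Qcyl 1 (T / R\<^sup>2)) (\<lambda>(y, s). f (R *\<^sub>R y) (R\<^sup>2 * s))"
    if "continuous_on (Qcyl R T) (\<lambda>(x, t). f x t)" for f :: "'a \<Rightarrow> real \<Rightarrow> 'c::topological_space"
  proof -
    have "continuous_on (Qcyl 1 (T / R\<^sup>2)) (\<lambda>z. (\<lambda>(x, t). f x t) (R *\<^sub>R fst z, R\<^sup>2 * snd z))"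
      by (rule continuous_on_compose2[OF that]) (use inQ in \<open>auto intro!: continuous_intros\<close>)
    then show ?thesis by (simp add: case_prod_unfold)
  qed
  have C: "continuous_on (Qcyl R T) (\<lambda>(x, t). u x t)" "continuous_on (Qcyl R T) (\<lambda>(x, t). gu x t)"
    "continuous_on (Qcyl R T) (\<lambda>(x, t). ut x t)"
    "\<And>i. i \<in> Basis \<Longrightarrow> continuous_on (Qcyl R T) (\<lambda>(x, t). Hu x t i)"
    using sol unfolding classical_sol_def by simp_all
  have sR: "((\<lambda>y. R *\<^sub>R y) has_derivative (\<lambda>h. R *\<^sub>R h)) (at y)" for y :: 'a
    by (auto intro!: derivative_eq_intros)
  have 1: "((\<lambda>y. R powr (\<beta> - 1) * u (R *\<^sub>R y) (R\<^sup>2 * s)) has_derivative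
      (\<lambda>h. (R powr \<beta> *\<^sub>R gu (R *\<^sub>R y) (R\<^sup>2 * s)) \<bullet> h)) (at y)"
    "((\<lambda>y. R powr \<beta> *\<^sub>R gu (R *\<^sub>R y) (R\<^sup>2 * s)) has_derivative
      (\<lambda>h. R powr (\<beta> + 1) *\<^sub>R Hu (R *\<^sub>R y) (R\<^sup>2 * s) h)) (at y)"
    "((\<lambda>s. R powr (\<beta> - 1) * u (R *\<^sub>R y) (R\<^sup>2 * s)) has_real_derivative
      R powr (\<beta> + 1) * ut (R *\<^sub>R y) (R\<^sup>2 * s)) (at s)"
    "R powr (\<beta> + 1) * ut (R *\<^sub>R y) (R\<^sup>2 * s) - (\<Sum>i\<in>Basis. R powr (\<beta> + 1) *\<^sub>R Hu (R *\<^sub>R y) (R\<^sup>2 * s) i \<bullet> i)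
      = norm (R powr \<beta> *\<^sub>R gu (R *\<^sub>R y) (R\<^sup>2 * s)) powr p"
    if "(y, s) \<in> Qcyl 1 (T / R\<^sup>2)" for y :: 'a and s
  proof -
    from inQ[OF that] have Q: "R *\<^sub>R y \<in> ball 0 R" "0 < R\<^sup>2 * s" "R\<^sup>2 * s < T" by (auto simp: Qcyl_def)
    note D = classical_solD[OF sol Q]
    from diff_chain_at[OF sR D(1)]
    have "((\<lambda>y. u (R *\<^sub>R y) (R\<^sup>2 * s)) has_derivative (\<lambda>h. R * (gu (R *\<^sub>R y) (R\<^sup>2 * s) \<bullet> h))) (at y)"
      by (simp add: o_def)
    from has_derivative_mult_right[OF this, of "R powr (\<beta> - 1)"]
    show "((\<lambda>y. R powr (\<beta> - 1) * u (R *\<^sub>R y) (R\<^sup>2 * s)) has_derivative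
      (\<lambda>h. (R powr \<beta> *\<^sub>R gu (R *\<^sub>R y) (R\<^sup>2 * s)) \<bullet> h)) (at y)"
      by (simp add: R1(1) mult_ac)
    from diff_chain_at[OF sR D(2)]
    have "((\<lambda>y. gu (R *\<^sub>R y) (R\<^sup>2 * s)) has_derivative (\<lambda>h. R *\<^sub>R Hu (R *\<^sub>R y) (R\<^sup>2 * s) h)) (at y)"
      by (simp add: o_def linear_cmul[OF has_derivative_linear[OF D(2)]])
    from has_derivative_scaleR_right[OF this, of "R powr \<beta>"]
    show "((\<lambda>y. R powr \<beta> *\<^sub>R gu (R *\<^sub>R y) (R\<^sup>2 * s)) has_derivative
      (\<lambda>h. R powr (\<beta> + 1) *\<^sub>R Hu (R *\<^sub>R y) (R\<^sup>2 * s) h)) (at y)"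
      by (simp add: R1(2))
    have "((\<lambda>s. R\<^sup>2 * s) has_real_derivative R\<^sup>2) (at s)" by (auto intro!: derivative_eq_intros)
    from DERIV_cmult[OF DERIV_chain2[OF D(3) this], of "R powr (\<beta> - 1)"]
    show "((\<lambda>s. R powr (\<beta> - 1) * u (R *\<^sub>R y) (R\<^sup>2 * s)) has_real_derivative
      R powr (\<beta> + 1) * ut (R *\<^sub>R y) (R\<^sup>2 * s)) (at s)"
      by (simp add: R1(3) mult_ac)
    have "norm (R powr \<beta> *\<^sub>R gu (R *\<^sub>R y) (R\<^sup>2 * s)) powr p = R powr (\<beta> + 1) * norm (gu (R *\<^sub>R y) (R\<^sup>2 * s)) powr p"
      by (simp add: powr_mult powr_powr \<beta>p)
    then show "R powr (\<beta> + 1) * ut (R *\<^sub>R y) (R\<^sup>2 * s) - (\<Sum>i\<in>Basis. R powr (\<beta> + 1) *\<^sub>R Hu (R *\<^sub>R y) (R\<^sup>2 * s) i \<bullet> i)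
      = norm (R powr \<beta> *\<^sub>R gu (R *\<^sub>R y) (R\<^sup>2 * s)) powr p"
      unfolding D(4)[symmetric] by (simp add: sum_distrib_left right_diff_distrib)
  qed
  have 2: "continuous_on (Qcyl 1 (T / R\<^sup>2)) (\<lambda>(y, s). R powr (\<beta> - 1) * u (R *\<^sub>R y) (R\<^sup>2 * s))"
    "continuous_on (Qcyl 1 (T / R\<^sup>2)) (\<lambda>(y, s). R powr \<beta> *\<^sub>R gu (R *\<^sub>R y) (R\<^sup>2 * s))"
    "continuous_on (Qcyl 1 (T / R\<^sup>2)) (\<lambda>(y, s). R powr (\<beta> + 1) * ut (R *\<^sub>R y) (R\<^sup>2 * s))"
    using cont[OF C(1)] cont[OF C(2)] cont[OF C(3)] unfolding case_prod_unfold
    by (auto intro!: continuous_on_mult continuous_on_scaleR continuous_on_const)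
  have 3: "continuous_on (Qcyl 1 (T / R\<^sup>2)) (\<lambda>(y, s). R powr (\<beta> + 1) *\<^sub>R Hu (R *\<^sub>R y) (R\<^sup>2 * s) i)" if "i \<in> Basis" for i
    using cont[OF C(4)[OF that]] unfolding case_prod_unfold
    by (intro continuous_on_scaleR continuous_on_const)
  show ?thesis
    unfolding classical_sol_def by (intro conjI allI impI ballI 1 2 3)
qed

lemma gradient_estimate:
  assumes p: "p > 2" and a: "0 < a" "a < 1"
  shows "\<exists>C>0. \<forall>R T (u :: 'a::euclidean_space \<Rightarrow> real \<Rightarrow> real) gu Hu ut x t.
    R > 0 \<and> classical_sol p R T u gu Hu ut \<and> norm x < R / 2 \<and> 0 < t \<and> t < T \<longrightarrow>
    a * norm (gu x t) powr p - ut x t \<le> C * (R powr (- (1/(p-1)) - 1) + R powr (1 - 1/(p-1)) / t)"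
proof -
  define \<beta> where "\<beta> = 1 / (p - 1)"
  have \<beta>p: "\<beta> * p = \<beta> + 1" using p by (simp add: \<beta>_def field_simps)
  from unit_estimate[OF p a, where 'a = 'a] obtain C where C: "C > 0"
    "\<And>T (u :: 'a \<Rightarrow> real \<Rightarrow> real) gu Hu ut x t.
    classical_sol p 1 T u gu Hu ut \<Longrightarrow> norm x < 1/2 \<Longrightarrow> 0 < t \<Longrightarrow> t < T \<Longrightarrow>
    a * norm (gu x t) powr p - ut x t \<le> C * (1 + 1 / t)" by blast
  have "a * norm (gu x t) powr p - ut x t \<le> C * (R powr (- \<beta> - 1) + R powr (1 - \<beta>) / t)"
    if R: "R > 0" and sol: "classical_sol p R T u gu Hu ut" and x: "norm x < R / 2" and t: "0 < t" "t < T"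
    for R T and u :: "'a \<Rightarrow> real \<Rightarrow> real" and gu Hu ut x t
  proof -
    define y where "y = x /\<^sub>R R"
    have y: "R *\<^sub>R y = x" "R\<^sup>2 * (t / R\<^sup>2) = t" using R by (simp_all add: y_def)
    have "norm y < 1/2" using R x by (simp add: y_def field_simps)
    from C(2)[OF classical_sol_rescale[OF sol p R] this, of "t / R\<^sup>2"] R t
    have "a * norm (R powr \<beta> *\<^sub>R gu x t) powr p - R powr (\<beta> + 1) * ut x t \<le> C * (1 + R\<^sup>2 / t)"
      unfolding y \<beta>_def[symmetric] by (simp add: divide_strict_right_mono)
    then have "R powr (\<beta> + 1) * (a * norm (gu x t) powr p - ut x t) \<le> C * (1 + R\<^sup>2 / t)"
      by (simp add: powr_mult powr_powr \<beta>p algebra_simps)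
    \<comment> \<open>Undoing the scaling turns 1 + R^2 / t into R^(-\<beta>-1) + R^(1-\<beta>) /
      t.\<close>
    then have "R powr (- \<beta> - 1) * (R powr (\<beta> + 1) * (a * norm (gu x t) powr p - ut x t))
        \<le> R powr (- \<beta> - 1) * (C * (1 + R\<^sup>2 / t))"
      by (intro mult_left_mono) auto
    moreover have "R powr (- \<beta> - 1) * (R powr (\<beta> + 1) * X) = X" for X
      using R by (simp add: mult.assoc[symmetric] powr_add[symmetric])
    moreover have "R powr (- \<beta> - 1) * (C * (1 + R\<^sup>2 / t)) = C * (R powr (- \<beta> - 1) + R powr (1 - \<beta>) / t)"
    proof -
      have "R\<^sup>2 = R powr 2" using R by simp
      moreover have "R powr (- \<beta> - 1) * R powr 2 = R powr (1 - \<beta>)"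
        unfolding powr_add[symmetric] by simp
      ultimately have "R powr (- \<beta> - 1) * R\<^sup>2 = R powr (1 - \<beta>)" by (simp only:)
      then show ?thesis by (simp add: distrib_left mult.left_commute)
    qed
    ultimately show ?thesis by (simp only:)
  qed
  with C(1) show ?thesis unfolding \<beta>_def by blast
qed

section \<open>Comparison of values along space-time segments\<close>

text \<open>Young's inequality with the coefficient of r^p fixed at 1/2, the amount that the
  gradient estimate with a = 1/2 can absorb. Either v is at most r^(p-1) / 2, or r is at most (2
  v)^(1/(p-1)).\<close>

lemma powr_absorb_product:
  fixes p r v :: real
  assumes "p > 1" "r \<ge> 0" "v \<ge> 0"
  shows "r * v \<le> 1/2 * r powr p + 2 powr (1/(p-1)) * v powr (1 + 1/(p-1))"
proof (cases "v \<le> 1/2 * r powr (p - 1)")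
  case True
  then have "r * v \<le> r * (1/2 * r powr (p - 1))" using assms by (intro mult_left_mono)
  also have "\<dots> = 1/2 * r powr p" using assms by (cases "r = 0") (auto simp: powr_diff)
  also have "\<dots> \<le> 1/2 * r powr p + 2 powr (1/(p-1)) * v powr (1 + 1/(p-1))" by simp
  finally show ?thesis .
next
  case False
  then have v: "v > 0" using powr_ge_zero[of r "p - 1"] by linarith
  have "r = (r powr (p - 1)) powr (1/(p-1))" using assms by (simp add: powr_powr)
  also have "\<dots> \<le> (2 * v) powr (1/(p-1))" using False assms by (intro powr_mono2) auto
  finally have "r * v \<le> (2 * v) powr (1/(p-1)) * v" using v by simp
  also have "\<dots> = 2 powr (1/(p-1)) * v powr (1 + 1/(p-1))" using v by (simp add: powr_mult powr_add)
  also have "\<dots> \<le> 1/2 * r powr p + 2 powr (1/(p-1)) * v powr (1 + 1/(p-1))" by simp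
  finally show ?thesis .
qed

text \<open>Integrates the gradient estimate with \<open>a = 1/2\<close> along the segment from \<open>(x, t)\<close> to \<open>(y, s)\<close>.\<close>
lemma harnack_of_gradient_estimate:
  fixes u :: "'a::euclidean_space \<Rightarrow> real \<Rightarrow> real" and p :: real
  defines "\<beta> \<equiv> 1 / (p - 1)"
  assumes p: "p > 2" and sol: "classical_sol p R T u gu Hu ut" and C: "C \<ge> 0"
    and est: "\<And>x t. norm x < R / 2 \<Longrightarrow> 0 < t \<Longrightarrow> t < T \<Longrightarrow>
      1/2 * norm (gu x t) powr p - ut x t \<le> C * (R powr (- \<beta> - 1) + R powr (1 - \<beta>) / t)"
    and x: "x \<in> ball 0 (R/2)" and y: "y \<in> ball 0 (R/2)" and ts: "0 < t" "t < s" "s < T"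
  shows "u x t \<le> u y s + 2 powr \<beta> * (norm (y - x) powr p / (s - t)) powr \<beta>
    + C * (R powr (- \<beta> - 1) + R powr (1 - \<beta>) / t) * (s - t)"
proof -
  have \<beta>p: "p * \<beta> = 1 + \<beta>" "\<beta> > 0" using p by (simp_all add: \<beta>_def field_simps)
  \<comment> \<open>\<open>V\<close> is the constant velocity of the segment.\<close>
  define V where "V = (y - x) /\<^sub>R (s - t)"
  define \<gamma> where "\<gamma> \<sigma> = x + (\<sigma> - t) *\<^sub>R V" for \<sigma>
  define K where "K = 2 powr \<beta> * norm V powr (1 + \<beta>) + C * (R powr (- \<beta> - 1) + R powr (1 - \<beta>) / t)"
  have ends: "\<gamma> t = x" "\<gamma> s = y" using ts by (simp_all add: \<gamma>_def V_def)
  have in_ball: "norm (\<gamma> \<sigma>) < R / 2" if "t \<le> \<sigma>" "\<sigma> \<le> s" for \<sigma>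
  proof -
    define \<mu> where "\<mu> = (\<sigma> - t) / (s - t)"
    have "\<gamma> \<sigma> = (1 - \<mu>) *\<^sub>R x + \<mu> *\<^sub>R y"
      by (simp add: \<gamma>_def V_def \<mu>_def algebra_simps divide_inverse)
    moreover have "0 \<le> \<mu>" "\<mu> \<le> 1" using that ts by (auto simp: \<mu>_def)
    ultimately have "\<gamma> \<sigma> \<in> ball 0 (R/2)"
      using convexD_alt[OF convex_ball x y, of \<mu>] by simp
    then show ?thesis by simp
  qed
  have der: "((\<lambda>\<sigma>. u (\<gamma> \<sigma>) \<sigma>) has_real_derivative gu (\<gamma> \<sigma>) \<sigma> \<bullet> V + ut (\<gamma> \<sigma>) \<sigma>) (at \<sigma>)"
    if \<sigma>: "t \<le> \<sigma>" "\<sigma> \<le> s" for \<sigma>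
  proof -
    have "norm x < R / 2" using x by simp
    then have "R > 0" using norm_ge_zero[of x] by linarith
    then have "\<gamma> \<sigma> \<in> ball 0 R" using in_ball[OF \<sigma>] by simp
    from classical_sol_joint_derivative[OF sol this, of \<sigma>] \<sigma> ts
    have J: "((\<lambda>(x, t). u x t) has_derivative (\<lambda>(h, r). gu (\<gamma> \<sigma>) \<sigma> \<bullet> h + r * ut (\<gamma> \<sigma>) \<sigma>)) (at (\<gamma> \<sigma>, \<sigma>))"
      by simp
    have "((\<lambda>\<sigma>. (\<gamma> \<sigma>, \<sigma>)) has_derivative (\<lambda>r. (r *\<^sub>R V, r))) (at \<sigma>)"
      unfolding \<gamma>_def by (auto intro!: derivative_eq_intros)
    from diff_chain_at[OF this J]
    have "((\<lambda>\<sigma>. u (\<gamma> \<sigma>) \<sigma>) has_derivative (\<lambda>r. r * (gu (\<gamma> \<sigma>) \<sigma> \<bullet> V + ut (\<gamma> \<sigma>) \<sigma>))) (at \<sigma>)"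
      by (simp add: o_def distrib_left)
    then show ?thesis by (simp add: has_field_derivative_def mult_commute_abs)
  qed
  \<comment> \<open>The mean value theorem does the work of integration, since the lower bound -K
    for the derivative holds at every intermediate time.\<close>
  obtain \<sigma> where \<sigma>: "t < \<sigma>" "\<sigma> < s"
    "u (\<gamma> s) s - u (\<gamma> t) t = (s - t) * (gu (\<gamma> \<sigma>) \<sigma> \<bullet> V + ut (\<gamma> \<sigma>) \<sigma>)"
    using MVT2[OF ts(2) der] by blast
  have "- K \<le> gu (\<gamma> \<sigma>) \<sigma> \<bullet> V + ut (\<gamma> \<sigma>) \<sigma>"
  proof -
    define r where "r = norm (gu (\<gamma> \<sigma>) \<sigma>)"
    have "- (gu (\<gamma> \<sigma>) \<sigma> \<bullet> V) \<le> r * norm V"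
      using Cauchy_Schwarz_ineq2[of "gu (\<gamma> \<sigma>) \<sigma>" V] unfolding r_def by linarith
    also have "\<dots> \<le> 1/2 * r powr p + 2 powr \<beta> * norm V powr (1 + \<beta>)"
      unfolding \<beta>_def using p by (intro powr_absorb_product) (auto simp: r_def)
    finally have "- (gu (\<gamma> \<sigma>) \<sigma> \<bullet> V) \<le> 1/2 * r powr p + 2 powr \<beta> * norm V powr (1 + \<beta>)" .
    moreover have "1/2 * r powr p - ut (\<gamma> \<sigma>) \<sigma> \<le> C * (R powr (- \<beta> - 1) + R powr (1 - \<beta>) / \<sigma>)"
      unfolding r_def using \<sigma> ts by (intro est in_ball) auto
    moreover have "C * (R powr (- \<beta> - 1) + R powr (1 - \<beta>) / \<sigma>) \<le> C * (R powr (- \<beta> - 1) + R powr (1 - \<beta>) / t)"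
      using \<sigma> ts C by (intro mult_left_mono add_left_mono divide_left_mono) auto
    ultimately show ?thesis unfolding K_def by linarith
  qed
  then have "(s - t) * (- K) \<le> u y s - u x t"
    unfolding \<sigma>(3)[unfolded ends] using ts by (intro mult_left_mono) auto
  \<comment> \<open>The exponents match because 1 + \<beta> = p \<beta>.\<close>
  moreover have "(s - t) * norm V powr (1 + \<beta>) = (norm (y - x) powr p / (s - t)) powr \<beta>"
  proof -
    have "norm V = norm (y - x) / (s - t)" using ts by (simp add: V_def divide_inverse mult.commute)
    then have "(s - t) * norm V powr (1 + \<beta>) = norm (y - x) powr (1 + \<beta>) * ((s - t) / (s - t) powr (1 + \<beta>))"
      using ts by (simp add: powr_divide)
    also have "(s - t) / (s - t) powr (1 + \<beta>) = 1 / (s - t) powr \<beta>"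
      using ts by (simp add: powr_add)
    finally show ?thesis using ts by (simp add: powr_divide powr_powr \<beta>p)
  qed
  then have "(s - t) * K = 2 powr \<beta> * (norm (y - x) powr p / (s - t)) powr \<beta>
    + C * (R powr (- \<beta> - 1) + R powr (1 - \<beta>) / t) * (s - t)"
    unfolding K_def by (simp only: distrib_left[of "s - t"] mult.left_commute[of "s - t" "2 powr \<beta>"] mult.commute[of "s - t" "C * _"])
  ultimately show ?thesis by simp
qed

section \<open>Both estimates with uniform constants\<close>

theorem theorem2p7:
  fixes p :: real
  assumes "p > 2"
  shows
   "(\<forall>a. 0 \<le> a \<and> a < 1 \<longrightarrow>
      (\<exists>C>0. \<forall>R T (u :: 'a::euclidean_space \<Rightarrow> real \<Rightarrow> real) gu Hu ut.
         R > 0 \<and> T > 0 \<and> classical_sol p R T u gu Hu ut \<longrightarrow>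
         (\<forall>x t. x \<in> ball 0 (R/2) \<and> 0 < t \<and> t < T \<longrightarrow>
            a * norm (gu x t) powr p - ut x t
              \<le> C * (R powr (- (1/(p-1)) - 1) + R powr (1 - 1/(p-1)) / t)))) \<and>
    (\<exists>C>0. \<forall>R T (u :: 'a \<Rightarrow> real \<Rightarrow> real) gu Hu ut.
         R > 0 \<and> T > 0 \<and> classical_sol p R T u gu Hu ut \<longrightarrow>
         (\<forall>x y t s. x \<in> ball 0 (R/2) \<and> y \<in> ball 0 (R/2) \<and> 0 < t \<and> t < s \<and> s < T \<longrightarrow>
            u x t \<le> u y s + C * (norm (y - x) powr p / (s - t)) powr (1/(p-1))
                     + C * (R powr (- (1/(p-1)) - 1) + R powr (1 - 1/(p-1)) / t) * (s - t)))"
proof (intro conjI allI impI)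
  fix a :: real assume a: "0 \<le> a \<and> a < 1"
  \<comment> \<open>The Bernstein argument needs a > 0. Since the left-hand side increases with a,
    the estimate for the larger \<open>a'\<close> implies the one for a, including a = 0.\<close>
  define a' where "a' = max a (1/2)"
  have a': "0 < a'" "a' < 1" "a \<le> a'" using a by (auto simp: a'_def)
  obtain C where C: "C > 0" "\<And>R T (u :: 'a \<Rightarrow> real \<Rightarrow> real) gu Hu ut x t.
    R > 0 \<Longrightarrow> classical_sol p R T u gu Hu ut \<Longrightarrow> norm x < R / 2 \<Longrightarrow> 0 < t \<Longrightarrow> t < T \<Longrightarrow>
    a' * norm (gu x t) powr p - ut x t \<le> C * (R powr (- (1/(p-1)) - 1) + R powr (1 - 1/(p-1)) / t)"
    using gradient_estimate[OF assms a'(1,2), where 'a = 'a] by blast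
  show "\<exists>C>0. \<forall>R T (u :: 'a \<Rightarrow> real \<Rightarrow> real) gu Hu ut.
         R > 0 \<and> T > 0 \<and> classical_sol p R T u gu Hu ut \<longrightarrow>
         (\<forall>x t. x \<in> ball 0 (R/2) \<and> 0 < t \<and> t < T \<longrightarrow>
            a * norm (gu x t) powr p - ut x t
              \<le> C * (R powr (- (1/(p-1)) - 1) + R powr (1 - 1/(p-1)) / t))"
  proof (intro exI[of _ C] conjI allI impI C(1))
    fix R T and u :: "'a \<Rightarrow> real \<Rightarrow> real" and gu Hu ut and x :: 'a and t
    assume "R > 0 \<and> T > 0 \<and> classical_sol p R T u gu Hu ut" "x \<in> ball 0 (R/2) \<and> 0 < t \<and> t < T"
    then have "a' * norm (gu x t) powr p - ut x t \<le> C * (R powr (- (1/(p-1)) - 1) + R powr (1 - 1/(p-1)) / t)"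
      by (intro C(2)) auto
    moreover have "a * norm (gu x t) powr p \<le> a' * norm (gu x t) powr p"
      using a' by (intro mult_right_mono) auto
    ultimately show "a * norm (gu x t) powr p - ut x t
              \<le> C * (R powr (- (1/(p-1)) - 1) + R powr (1 - 1/(p-1)) / t)" by linarith
  qed
next
  obtain C where C: "C > 0" "\<And>R T (u :: 'a \<Rightarrow> real \<Rightarrow> real) gu Hu ut x t.
    R > 0 \<Longrightarrow> classical_sol p R T u gu Hu ut \<Longrightarrow> norm x < R / 2 \<Longrightarrow> 0 < t \<Longrightarrow> t < T \<Longrightarrow>
    1/2 * norm (gu x t) powr p - ut x t \<le> C * (R powr (- (1/(p-1)) - 1) + R powr (1 - 1/(p-1)) / t)"
    using gradient_estimate[OF assms, of "1/2", where 'a = 'a] by auto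
  \<comment> \<open>A single constant has to serve both error terms, so the two factors are
    added.\<close>
  define C' where "C' = C + 2 powr (1/(p-1))"
  have C': "C' > 0" "C \<le> C'" "2 powr (1/(p-1)) \<le> C'" using C(1) by (simp_all add: C'_def add_pos_nonneg)
  show "\<exists>C>0. \<forall>R T (u :: 'a \<Rightarrow> real \<Rightarrow> real) gu Hu ut.
         R > 0 \<and> T > 0 \<and> classical_sol p R T u gu Hu ut \<longrightarrow>
         (\<forall>x y t s. x \<in> ball 0 (R/2) \<and> y \<in> ball 0 (R/2) \<and> 0 < t \<and> t < s \<and> s < T \<longrightarrow>
            u x t \<le> u y s + C * (norm (y - x) powr p / (s - t)) powr (1/(p-1))
                     + C * (R powr (- (1/(p-1)) - 1) + R powr (1 - 1/(p-1)) / t) * (s - t))"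
  proof (intro exI[of _ C'] conjI allI impI C'(1))
    fix R T and u :: "'a \<Rightarrow> real \<Rightarrow> real" and gu Hu ut and x y :: 'a and t s
    assume 1: "R > 0 \<and> T > 0 \<and> classical_sol p R T u gu Hu ut"
      and 2: "x \<in> ball 0 (R/2) \<and> y \<in> ball 0 (R/2) \<and> 0 < t \<and> t < s \<and> s < T"
    let ?N = "(norm (y - x) powr p / (s - t)) powr (1/(p-1))"
    let ?E = "R powr (- (1/(p-1)) - 1) + R powr (1 - 1/(p-1)) / t"
    have "u x t \<le> u y s + 2 powr (1/(p-1)) * ?N + C * ?E * (s - t)"
      by (rule harnack_of_gradient_estimate[OF assms, where T = T]) (use 1 2 C in auto)
    also have "\<dots> \<le> u y s + C' * ?N + C' * ?E * (s - t)"
      using C' 2 by (intro add_mono mult_right_mono order_refl) auto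
    finally show "u x t \<le> u y s + C' * ?N + C' * ?E * (s - t)" .
  qed
qed

end
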